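(* Consider the vehicle chain $s^2x_i(s)=u_i(s)+d_i(s)$, $i=0,1,\dots,N$, with configuration errors $e_i(s)=x_{i-1}(s)-x_i(s)$, $i=1,\dots,N$ (time-headway $h=0$), and with controllers using local communication: $u_0=0$, $v_0=0$ and, for $i=1,\dots,N$, $$u_i=K(s)e_i+H(s)r_i,\qquad r_i=W(s)v_{i-1},\qquad v_i=F(s)e_i+G(s)r_i .$$ (a) There exist no $W,F,G,H,K$ satisfying Assumption 1 with $K(0)$ bounded, where each $v_i$ is possibly an $n$-dimensional vector signal for some $n\ge1$ (and $F,G,H,W$ are transfer matrices of appropriate dimensions), for which the chain is $(L_2,l_2)$ string stable. (b) For scalar signals $v_i$, there exist no $W,F,G,H,K$ satisfying Assumption 1 for which the chain is $L_2$ string stable, and thus a fortiori none for which it is $(L_2,l_2)$ string stable.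
   Context: Signals are described in the Laplace domain ($s=j\omega$ on the imaginary axis); the system is causal and starts at rest, initial conditions being modeled through the disturbances. $x_i$ is the configuration of vehicle $i$, $u_i$ its control input, $d_i$ a disturbance input; vehicle $0$ is the leader; $r_i$ is the communication signal received by vehicle $i$ from its predecessor and $v_i$ the signal sent by vehicle $i$. $K,H,F,G$ are controller transfer functions to be designed, with $K$ scalar and $K(0)\neq0$ (no cancellation of poles); $W$ is the bounded transfer function of the communication channel, not exactly known. All transfer functions are independent of $N$ and the same for all vehicles. "$K(0)$ bounded" means that $K$ has no pole at $s=0$. Assumption 1 (communication channel): (stability) the poles of $F,G,H,W$ all have negative real parts; (keeping unmodeled noise in check) $G(j\omega)$ and $F(j\omega)$ are bounded for all $\omega$, while $H$ may be of a similar form as $K$; (robustness) the controller cannot rely on perfect cancellation effects by matching of $W$ with $F,G,H$: effects that rely on an exact identity between $W$ and the designed transfer functions (e.g. $GW=1$ at a given frequency) are excluded, i.e. the string stability property must persist under arbitrary sufficiently small stable perturbations of $W$. Norms: $\Vert v_i(\cdot)\Vert_2=\big(\int_{-\infty}^{+\infty}v_i(t)^2dt\big)^{1/2}$ for a scalar signal, and $\Vert v(\cdot)\Vert_2=\big(\sum_i\int_{-\infty}^{+\infty}v_i(t)^2dt\big)^{1/2}$ for a vector of signals, summing over all components, with $e=(e_1,\dots,e_N)$, $d=(d_0,\dots,d_N)$. $(L_2,l_2)$ string stability: there exists a constant $c_1$ such that $\Vert e(\cdot)\Vert_2\le c_1\Vert d(\cdot)\Vert_2$ for all $d$ of bounded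 norm and all chain lengths $N$. $L_2$ string stability: there exists a constant $c$ such that $\Vert e_k(\cdot)\Vert_2\le c\,\Vert d_i(\cdot)\Vert_2$ for all $k$, for any situation with a disturbance $d_i$ of bounded norm at some single $i$ and zero disturbances at all other vehicles, and for all $N$. Both notions presuppose that the closed-loop system is stable for each $N$. *)

theory Defs
  imports "HOL-Complex_Analysis.Complex_Analysis"
begin

section \<open>Transfer functions\<close>

text \<open>
  A transfer function is a meromorphic function of the Laplace variable, so that delays are covered
  as well as rational functions; \<open>nicely_meromorphic_on\<close> fixes the value \<open>0\<close> at a pole and excludes
  removable singularities. Symmetry under conjugation says that real signals are mapped to real
  signals. Polynomial growth in some right half plane characterizes the Laplace transforms of
  distributions supported in \<open>t \<ge> 0\<close>, that is, causality; improper functions such as that of a PD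
  controller are allowed.
\<close>

definition causal :: "(complex \<Rightarrow> complex) \<Rightarrow> bool" where
  "causal f \<longleftrightarrow> (\<exists>\<sigma> C (m::nat). \<forall>s. Re s > \<sigma> \<longrightarrow> \<not> is_pole f s \<and> norm (f s) \<le> C * (1 + norm s) ^ m)"

definition transfer_function :: "(complex \<Rightarrow> complex) \<Rightarrow> bool" where
  "transfer_function f \<longleftrightarrow>
     f nicely_meromorphic_on UNIV \<and> (\<forall>s. f (cnj s) = cnj (f s)) \<and> causal f"

definition stable :: "(complex \<Rightarrow> complex) \<Rightarrow> bool" where
  "stable f \<longleftrightarrow> transfer_function f \<and> (\<forall>s. is_pole f s \<longrightarrow> Re s < 0)"

definition stable_vec :: "(complex \<Rightarrow> complex^'n) \<Rightarrow> bool" where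
  "stable_vec f \<longleftrightarrow> (\<forall>i. stable (\<lambda>s. f s $ i))"

definition stable_mat :: "(complex \<Rightarrow> complex^'n^'m) \<Rightarrow> bool" where
  "stable_mat f \<longleftrightarrow> (\<forall>i j. stable (\<lambda>s. f s $ i $ j))"

definition bounded_on_imaginary_axis :: "(complex \<Rightarrow> 'a::real_normed_vector) \<Rightarrow> bool" where
  "bounded_on_imaginary_axis f \<longleftrightarrow> (\<exists>B. \<forall>\<omega>::real. norm (f (\<i> * of_real \<omega>)) \<le> B)"


section \<open>Signals\<close>

definition L2_signal :: "(real \<Rightarrow> real) \<Rightarrow> bool" where
  "L2_signal f \<longleftrightarrow> f \<in> borel_measurable borel \<and> (\<forall>t<0. f t = 0) \<and> integrable lborel (\<lambda>t. (f t)\<^sup>2)"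

definition L2_norm :: "(real \<Rightarrow> real) \<Rightarrow> real" where
  "L2_norm f = sqrt (LINT t|lborel. (f t)\<^sup>2)"

definition L2_l2_norm :: "nat set \<Rightarrow> (nat \<Rightarrow> real \<Rightarrow> real) \<Rightarrow> real" where
  "L2_l2_norm I f = sqrt (\<Sum>i\<in>I. LINT t|lborel. (f i t)\<^sup>2)"

text \<open>Used only for signals vanishing at negative times; for square integrable ones the integral
  converges absolutely when \<open>Re s > 0\<close>.\<close>

definition laplace :: "(real \<Rightarrow> real) \<Rightarrow> complex \<Rightarrow> complex" where
  "laplace f s = (LINT t|lborel. of_real (f t) * exp (- s * of_real t))"


section \<open>The vehicle chain\<close>

text \<open>
  The equations at a fixed value of the Laplace variable. The signals \<open>v i\<close> are \<open>'n\<close>-dimensional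
  and the received signals \<open>r i\<close> are \<open>'m\<close>-dimensional, hence \<open>F s\<close> is a column and \<open>H s\<close> is a row.
\<close>

definition chain_eqs ::
  "(complex \<Rightarrow> complex) \<Rightarrow> (complex \<Rightarrow> complex^'m) \<Rightarrow> (complex \<Rightarrow> complex^'n) \<Rightarrow>
   (complex \<Rightarrow> complex^'m^'n) \<Rightarrow> (complex \<Rightarrow> complex^'n^'m) \<Rightarrow> nat \<Rightarrow> complex \<Rightarrow>
   (nat \<Rightarrow> complex) \<Rightarrow> (nat \<Rightarrow> complex) \<Rightarrow> bool" where
  "chain_eqs K H F G W N s d e \<longleftrightarrow>
     (\<exists>(x :: nat \<Rightarrow> complex) (u :: nat \<Rightarrow> complex) (r :: nat \<Rightarrow> complex^'m) (v :: nat \<Rightarrow> complex^'n).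
        (\<forall>i\<in>{0..N}. s\<^sup>2 * x i = u i + d i) \<and>
        (\<forall>i\<in>{1..N}. e i = x (i - 1) - x i) \<and>
        u 0 = 0 \<and> v 0 = 0 \<and>
        (\<forall>i\<in>{1..N}. u i = K s * e i + (\<Sum>j\<in>UNIV. H s $ j * r i $ j)) \<and>
        (\<forall>i\<in>{1..N}. r i = W s *v v (i - 1)) \<and>
        (\<forall>i\<in>{1..N}. v i = e i *s F s + G s *v r i))"

text \<open>
  The quantifier \<open>\<forall>\<^sub>\<approx>\<close> omits a discrete set of values of \<open>s\<close>, such as poles. \<open>T i\<close> is the transfer
  function from the disturbance \<open>d j\<close> to the error \<open>e i\<close>.
\<close>

definition closed_loop_stable ::
  "(complex \<Rightarrow> complex) \<Rightarrow> (complex \<Rightarrow> complex^'m) \<Rightarrow> (complex \<Rightarrow> complex^'n) \<Rightarrow>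
   (complex \<Rightarrow> complex^'m^'n) \<Rightarrow> (complex \<Rightarrow> complex^'n^'m) \<Rightarrow> nat \<Rightarrow> bool" where
  "closed_loop_stable K H F G W N \<longleftrightarrow>
     (\<forall>j\<in>{0..N}. \<exists>T :: nat \<Rightarrow> complex \<Rightarrow> complex.
        (\<forall>i\<in>{1..N}. stable (T i)) \<and>
        (\<forall>\<^sub>\<approx>s\<in>UNIV. chain_eqs K H F G W N s (\<lambda>i. if i = j then 1 else 0) (\<lambda>i. T i s)))"

text \<open>
  The square integrable errors \<open>e 1, \<dots>, e N\<close> caused by square integrable disturbances
  \<open>d 0, \<dots>, d N\<close>. If \<open>K s + s\<^sup>2\<close> does not vanish identically then the errors are determined
  up to null sets, so that below it does not matter that they are quantified existentially.
\<close>

definition chain_response ::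
  "(complex \<Rightarrow> complex) \<Rightarrow> (complex \<Rightarrow> complex^'m) \<Rightarrow> (complex \<Rightarrow> complex^'n) \<Rightarrow>
   (complex \<Rightarrow> complex^'m^'n) \<Rightarrow> (complex \<Rightarrow> complex^'n^'m) \<Rightarrow> nat \<Rightarrow>
   (nat \<Rightarrow> real \<Rightarrow> real) \<Rightarrow> (nat \<Rightarrow> real \<Rightarrow> real) \<Rightarrow> bool" where
  "chain_response K H F G W N d e \<longleftrightarrow>
     (\<forall>i\<in>{1..N}. L2_signal (e i)) \<and>
     (\<forall>\<^sub>\<approx>s\<in>{s. Re s > 0}.
        chain_eqs K H F G W N s (\<lambda>i. laplace (d i) s) (\<lambda>i. laplace (e i) s))"


section \<open>String stability\<close>

definition L2_l2_string_stable ::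
  "(complex \<Rightarrow> complex) \<Rightarrow> (complex \<Rightarrow> complex^'m) \<Rightarrow> (complex \<Rightarrow> complex^'n) \<Rightarrow>
   (complex \<Rightarrow> complex^'m^'n) \<Rightarrow> (complex \<Rightarrow> complex^'n^'m) \<Rightarrow> bool" where
  "L2_l2_string_stable K H F G W \<longleftrightarrow>
     (\<forall>N. closed_loop_stable K H F G W N) \<and>
     (\<exists>c\<^sub>1. \<forall>N d. (\<forall>i\<in>{0..N}. L2_signal (d i)) \<longrightarrow>
        (\<exists>e. chain_response K H F G W N d e \<and> L2_l2_norm {1..N} e \<le> c\<^sub>1 * L2_l2_norm {0..N} d))"

definition L2_string_stable ::
  "(complex \<Rightarrow> complex) \<Rightarrow> (complex \<Rightarrow> complex^'m) \<Rightarrow> (complex \<Rightarrow> complex^'n) \<Rightarrow>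
   (complex \<Rightarrow> complex^'m^'n) \<Rightarrow> (complex \<Rightarrow> complex^'n^'m) \<Rightarrow> bool" where
  "L2_string_stable K H F G W \<longleftrightarrow>
     (\<forall>N. closed_loop_stable K H F G W N) \<and>
     (\<exists>c. \<forall>N d. \<forall>i\<in>{0..N}. L2_signal (d i) \<and> (\<forall>j. j \<noteq> i \<longrightarrow> d j = (\<lambda>t. 0)) \<longrightarrow>
        (\<exists>e. chain_response K H F G W N d e \<and> (\<forall>k\<in>{1..N}. L2_norm (e k) \<le> c * L2_norm (d i))))"


section \<open>Assumptions on controllers and channel\<close>

definition admissible_channel :: "(complex \<Rightarrow> complex^'n^'m) \<Rightarrow> bool" where
  "admissible_channel W \<longleftrightarrow> stable_mat W \<and> bounded_on_imaginary_axis W"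

text \<open>\<open>K(0) \<noteq> 0\<close> includes the case of a pole at \<open>0\<close>, where \<open>K 0 = 0\<close> by convention.\<close>

definition admissible_controllers ::
  "(complex \<Rightarrow> complex) \<Rightarrow> (complex \<Rightarrow> complex^'m) \<Rightarrow> (complex \<Rightarrow> complex^'n) \<Rightarrow>
   (complex \<Rightarrow> complex^'m^'n) \<Rightarrow> bool" where
  "admissible_controllers K H F G \<longleftrightarrow>
     transfer_function K \<and> (is_pole K 0 \<or> K 0 \<noteq> 0) \<and>
     stable_vec H \<and> stable_vec F \<and> stable_mat G \<and>
     bounded_on_imaginary_axis F \<and> bounded_on_imaginary_axis G"

text \<open>The perturbations are small in the \<open>H\<^sub>\<infinity>\<close> norm, the supremum over the closed right half plane;
  the choice \<open>W' = W\<close> is included.\<close>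

definition robustly ::
  "((complex \<Rightarrow> complex^'n^'m) \<Rightarrow> bool) \<Rightarrow> (complex \<Rightarrow> complex^'n^'m) \<Rightarrow> bool" where
  "robustly P W \<longleftrightarrow>
     (\<exists>\<epsilon>>0. \<forall>W'. admissible_channel W' \<and> (\<forall>s. Re s \<ge> 0 \<longrightarrow> norm (W' s - W s) \<le> \<epsilon>) \<longrightarrow> P W')"

text \<open>The robustness requirement refers to the string stability property \<open>P\<close> under study.\<close>

definition communication_assumption ::
  "((complex \<Rightarrow> complex^'n^'m) \<Rightarrow> bool) \<Rightarrow>
   (complex \<Rightarrow> complex) \<Rightarrow> (complex \<Rightarrow> complex^'m) \<Rightarrow> (complex \<Rightarrow> complex^'n) \<Rightarrow>
   (complex \<Rightarrow> complex^'m^'n) \<Rightarrow> (complex \<Rightarrow> complex^'n^'m) \<Rightarrow> bool" where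
  "communication_assumption P K H F G W \<longleftrightarrow>
     admissible_controllers K H F G \<and> admissible_channel W \<and> robustly P W"

end

theory Submission
  imports Defs
begin

text \<open>
  By Cauchy--Schwarz, \<open>\<bar>e(s)\<bar> \<le> \<parallel>e\<parallel> / sqrt (2 Re s)\<close> for the Laplace transform of a signal, so
  a string stability bound for disturbances of the leader bounds the transfer functions \<open>T\<^sub>i\<close> from
  \<open>d\<^sub>0\<close> to \<open>e\<^sub>i\<close> at points of the open right half plane, and Plancherel's theorem is not needed.

  (a) Letting \<open>s \<rightarrow> 0\<close> along the positive reals, the sum of the \<open>\<bar>T\<^sub>i(0)\<bar>\<^sup>2\<close> is finite, so \<open>T\<^sub>i(0) \<rightarrow> 0\<close>,
  whereas \<open>K T\<^sub>i + H W v\<^sub>i\<^sub>-\<^sub>1 = 1\<close> at \<open>s = 0\<close>. Hence \<open>H W v\<^sub>i \<rightarrow> 1\<close>, where \<open>v\<^sub>i = F T\<^sub>i + G W v\<^sub>i\<^sub>-\<^sub>1\<close> with a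
  vanishing input. A polynomial annihilating \<open>G W\<close> shows that then \<open>1\<close> is one of its roots, a
  coincidence that is destroyed by changing the gain of \<open>W\<close>.

  (b) In the scalar case \<open>T\<^sub>i\<close> satisfies a linear recurrence of order two. After a change of the gain of
  \<open>W\<close>, one of its characteristic roots is \<open>1 + \<kappa> s\<^sup>m (1 + o(1))\<close> as \<open>s \<rightarrow> 0\<close> with \<open>m \<ge> 2\<close> and \<open>\<kappa> \<noteq> 0\<close>, because
  the plant is a double integrator. It has modulus greater than \<open>1\<close> at some points of the open right
  half plane near \<open>0\<close>, and there \<open>T\<^sub>i\<close> grows exponentially in \<open>i\<close>.
\<close>

section \<open>Signals and their Laplace transforms\<close>

lemma integral_Cauchy_Schwarz:
  fixes f g :: "'a \<Rightarrow> real"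
  assumes f: "f \<in> borel_measurable M" "integrable M (\<lambda>x. (f x)\<^sup>2)"
    and g: "g \<in> borel_measurable M" "integrable M (\<lambda>x. (g x)\<^sup>2)"
    and pos: "(LINT x|M. (g x)\<^sup>2) > 0"
  shows "(LINT x|M. \<bar>f x * g x\<bar>)\<^sup>2 \<le> (LINT x|M. (f x)\<^sup>2) * (LINT x|M. (g x)\<^sup>2)"
proof -
  have fg: "integrable M (\<lambda>x. \<bar>f x * g x\<bar>)"
  proof (rule Bochner_Integration.integrable_bound)
    show "integrable M (\<lambda>x. (f x)\<^sup>2 + (g x)\<^sup>2)" using f g by simp
    show "(\<lambda>x. \<bar>f x * g x\<bar>) \<in> borel_measurable M" using f g by simp
    have "\<bar>a * b\<bar> \<le> a\<^sup>2 + b\<^sup>2" for a b :: real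
    proof -
      have "0 \<le> (\<bar>a\<bar> - \<bar>b\<bar>)\<^sup>2" by simp
      then have "2 * \<bar>a * b\<bar> \<le> a\<^sup>2 + b\<^sup>2" by (simp add: power2_diff abs_mult)
      then show ?thesis by linarith
    qed
    then show "AE x in M. norm \<bar>f x * g x\<bar> \<le> norm ((f x)\<^sup>2 + (g x)\<^sup>2)" by simp
  qed
  define a b m where "a = (LINT x|M. (f x)\<^sup>2)" and "b = (LINT x|M. (g x)\<^sup>2)"
    and "m = (LINT x|M. \<bar>f x * g x\<bar>)"
  \<comment> \<open>The minimizer of the quadratic \<open>a - 2 * t * m + t\<^sup>2 * b\<close>,
    whose nonnegativity gives the claim.\<close>
  define t where "t = m / b"
  have b: "b > 0" using pos by (simp add: b_def)
  have "0 \<le> (LINT x|M. (\<bar>f x\<bar> - t * \<bar>g x\<bar>)\<^sup>2)" by simp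
  also have "\<dots> = (LINT x|M. (f x)\<^sup>2 - 2 * t * \<bar>f x * g x\<bar> + t\<^sup>2 * (g x)\<^sup>2)"
    by (rule Bochner_Integration.integral_cong)
      (auto simp: power2_diff abs_mult power_mult_distrib)
  also have "\<dots> = a - 2 * t * m + t\<^sup>2 * b"
    using f g fg by (simp add: a_def b_def m_def)
  also have "\<dots> = a - m\<^sup>2 / b"
    using b by (simp add: t_def power2_eq_square field_simps)
  finally show ?thesis
    using b by (simp add: a_def b_def m_def field_simps)
qed

lemma norm_laplace_le:
  assumes e: "L2_signal e" and s: "Re s > 0"
  shows "(norm (laplace e s))\<^sup>2 \<le> (L2_norm e)\<^sup>2 / (2 * Re s)"
proof -
  define a where "a = Re s"
  \<comment> \<open>The modulus of the Laplace kernel, cut off to \<open>t \<ge> 0\<close> where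
    \<open>e\<close> lives; its square integral is \<open>1 / (2 * a)\<close>.\<close>
  define g :: "real \<Rightarrow> real" where "g = (\<lambda>t. exp (- a * t) * indicator {0..} t)"
  have a: "a > 0" using s by (simp add: a_def)
  have g2: "(g t)\<^sup>2 = exp (- (2 * a) * t) * indicator {0..} t" for t
    by (simp add: g_def power_mult_distrib exp_double[symmetric] indicator_def)
  have "(\<integral>\<^sup>+t. ennreal (exp (- (2 * a) * t)) * indicator {0..} t \<partial>lborel) = ennreal (0 - - exp (- (2 * a) * 0) / (2 * a))"
  proof (rule nn_integral_FTC_atLeast[where F = "\<lambda>t. - exp (- (2 * a) * t) / (2 * a)"])
    show "((\<lambda>t. - exp (- (2 * a) * t) / (2 * a)) \<longlongrightarrow> 0) at_top"
    proof -
      have "LIM t at_top. - (2 * a) * t :> at_bot"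
        using a by (intro filterlim_tendsto_neg_mult_at_bot[where c = "- (2 * a)"] tendsto_const filterlim_ident) auto
      from filterlim_compose[OF exp_at_bot this]
      have "((\<lambda>t. - exp (- (2 * a) * t) / (2 * a)) \<longlongrightarrow> - 0 / (2 * a)) at_top"
        by (intro tendsto_intros) (use a in auto)
      then show ?thesis by simp
    qed
  qed (use a in \<open>auto intro!: derivative_eq_intros simp: field_simps\<close>)
  then have "(\<integral>\<^sup>+t. ennreal ((g t)\<^sup>2) \<partial>lborel) = ennreal (1 / (2 * a))"
    by (simp add: g2 ennreal_mult' ennreal_indicator)
  then have hb: "has_bochner_integral lborel (\<lambda>t. (g t)\<^sup>2) (1 / (2 * a))"
    using a by (intro has_bochner_integral_nn_integral) (auto simp: g_def)
  have "norm (laplace e s) \<le> (LINT t|lborel. norm (of_real (e t) * exp (- s * of_real t)))"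
    unfolding laplace_def by (rule integral_norm_bound)
  also have "\<dots> = (LINT t|lborel. \<bar>e t * g t\<bar>)"
    using e by (intro Bochner_Integration.integral_cong)
      (auto simp: norm_mult g_def a_def L2_signal_def indicator_def abs_mult)
  finally have "(norm (laplace e s))\<^sup>2 \<le> (LINT t|lborel. \<bar>e t * g t\<bar>)\<^sup>2"
    by (intro power_mono) auto
  also have "\<dots> \<le> (LINT t|lborel. (e t)\<^sup>2) * (LINT t|lborel. (g t)\<^sup>2)"
    using e hb a by (intro integral_Cauchy_Schwarz)
      (auto simp: L2_signal_def has_bochner_integral_iff g_def)
  also have "\<dots> = (L2_norm e)\<^sup>2 / (2 * Re s)"
    using hb by (simp add: L2_norm_def has_bochner_integral_iff a_def)
  finally show ?thesis .
qed

lemma L2_signal_indicator: "L2_signal (indicator {0..b})"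
  unfolding L2_signal_def
proof (intro conjI allI impI)
  have "integrable lborel (\<lambda>t. indicator {0..b} t :: real)"
    by (rule integrable_real_indicator) (auto intro: emeasure_lborel_cbox_finite[of 0 b, simplified])
  then show "integrable lborel (\<lambda>t. (indicator {0..b} t :: real)\<^sup>2)"
    by (simp add: power2_eq_square indicator_inter_arith[symmetric])
qed (auto simp: indicator_def)

lemma L2_norm_indicator: "b \<ge> 0 \<Longrightarrow> L2_norm (indicator {0..b}) = sqrt b"
  by (simp add: L2_norm_def power2_eq_square indicator_inter_arith[symmetric])

lemma laplace_indicator:
  assumes "b \<ge> 0" "s \<noteq> 0"
  shows "laplace (indicator {0..b}) s = (1 - exp (- s * of_real b)) / s"
proof -
  have "((\<lambda>z. - exp (- s * z) / s) has_field_derivative exp (- s * z)) (at z)" for z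
    using assms by (auto intro!: derivative_eq_intros)
  note deriv = has_vector_derivative_real_field[OF this]
  have "has_bochner_integral lborel (\<lambda>t. indicator {0..b} t *\<^sub>R exp (- s * of_real t))
     (- exp (- s * of_real b) / s - - exp (- s * of_real 0) / s)"
    using assms by (intro has_bochner_integral_FTC_Icc deriv continuous_intros)
  then show ?thesis
    unfolding laplace_def has_bochner_integral_iff using assms
    by (simp add: scaleR_conv_of_real diff_divide_distrib)
qed

lemma laplace_zero [simp]: "laplace (\<lambda>t. 0) s = 0"
  by (simp add: laplace_def)

lemma L2_signal_zero [simp]: "L2_signal (\<lambda>t. 0)"
  by (simp add: L2_signal_def)

section \<open>The response to a disturbance of the leader\<close>

text \<open>
  With a unit disturbance of the leader, \<open>k = K(s)\<close>, \<open>z = s\<^sup>2\<close>, \<open>h = H W\<close> and \<open>A = G W\<close>, the state is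
  \<open>(x\<^sub>0 - x\<^sub>i, v\<^sub>i)\<close>. The index of \<open>chain_err\<close> is shifted: its value at \<open>i\<close> is the error \<open>e\<^sub>i\<^sub>+\<^sub>1\<close>.
\<close>

primrec chain_state ::
  "complex \<Rightarrow> complex \<Rightarrow> complex^'n \<Rightarrow> complex^'n \<Rightarrow> complex^'n^'n \<Rightarrow> nat \<Rightarrow> complex \<times> (complex^'n)" where
  "chain_state k z h F A 0 = (0, 0)"
| "chain_state k z h F A (Suc i) =
     (let (x, v) = chain_state k z h F A i;
          t = (1 - z * x - (\<Sum>j\<in>UNIV. h $ j * v $ j)) / (k + z)
      in (x + t, t *s F + A *v v))"

definition chain_err ::
  "complex \<Rightarrow> complex \<Rightarrow> complex^'n \<Rightarrow> complex^'n \<Rightarrow> complex^'n^'n \<Rightarrow> nat \<Rightarrow> complex" where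
  "chain_err k z h F A i =
     (1 - z * fst (chain_state k z h F A i) - (\<Sum>j\<in>UNIV. h $ j * snd (chain_state k z h F A i) $ j)) / (k + z)"

lemma chain_state_Suc:
  "fst (chain_state k z h F A (Suc i)) = fst (chain_state k z h F A i) + chain_err k z h F A i"
  "snd (chain_state k z h F A (Suc i)) = chain_err k z h F A i *s F + A *v snd (chain_state k z h F A i)"
  by (simp_all add: chain_err_def Let_def case_prod_unfold)

declare chain_state.simps(2) [simp del]

text \<open>Where \<open>K s + s\<^sup>2 \<noteq> 0\<close>, the equations can be solved for one
  error after the other, so every solution is the unit response scaled by \<open>D\<close>. This
  ties the existentially quantified signals to the explicit recursion.\<close>

lemma chain_eqs_imp_chain_err:
  fixes F :: "complex \<Rightarrow> complex^'n" and H :: "complex \<Rightarrow> complex^'m"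
  assumes eqs: "chain_eqs K H F G W N s (\<lambda>i. if i = 0 then D else 0) e"
    and nz: "K s + s\<^sup>2 \<noteq> 0" and i: "i < N"
  shows "e (Suc i) = D * chain_err (K s) (s\<^sup>2) (H s v* W s) (F s) (G s ** W s) i"
proof -
  obtain x u and r :: "nat \<Rightarrow> complex^'m" and v :: "nat \<Rightarrow> complex^'n" where
    x': "\<forall>i\<in>{0..N}. s\<^sup>2 * x i = u i + (if i = 0 then D else 0)" and
    e: "\<forall>i\<in>{1..N}. e i = x (i - 1) - x i" and
    0: "u 0 = 0" "v 0 = 0" and
    u: "\<forall>i\<in>{1..N}. u i = K s * e i + (\<Sum>j\<in>UNIV. H s $ j * r i $ j)" and
    r: "\<forall>i\<in>{1..N}. r i = W s *v v (i - 1)" and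
    v: "\<forall>i\<in>{1..N}. v i = e i *s F s + G s *v r i"
    using eqs unfolding chain_eqs_def by blast
  note x = x'[rule_format] and e = e[rule_format] and u = u[rule_format]
    and r = r[rule_format] and v = v[rule_format]
  define X where "X i = fst (chain_state (K s) (s\<^sup>2) (H s v* W s) (F s) (G s ** W s) i)" for i
  define V where "V i = snd (chain_state (K s) (s\<^sup>2) (H s v* W s) (F s) (G s ** W s) i)" for i
  define T where "T i = chain_err (K s) (s\<^sup>2) (H s v* W s) (F s) (G s ** W s) i" for i
  have HW: "(\<Sum>j\<in>UNIV. H s $ j * (W s *v w) $ j) = (\<Sum>j\<in>UNIV. (H s v* W s) $ j * w $ j)" for w
    by (simp add: matrix_vector_mult_def vector_matrix_mult_def sum_distrib_left sum_distrib_right)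
      (subst sum.swap, simp add: mult_ac)
  have step: "e (Suc i) = D * T i" if "i < N" and IH: "x i = x 0 - D * X i" "v i = D *s V i" for i
  proof -
    have "s\<^sup>2 * x (Suc i) = K s * e (Suc i) + D * (\<Sum>j\<in>UNIV. (H s v* W s) $ j * V i $ j)"
    proof -
      have "(\<Sum>j\<in>UNIV. H s $ j * (W s *v (D *s V i)) $ j) = D * (\<Sum>j\<in>UNIV. (H s v* W s) $ j * V i $ j)"
        unfolding HW by (simp add: sum_distrib_left mult_ac)
      then show ?thesis
        using x[of "Suc i"] u[of "Suc i"] r[of "Suc i"] that by simp
    qed
    moreover have "x (Suc i) = x 0 - D * X i - e (Suc i)"
      using e[of "Suc i"] that by simp
    moreover have "s\<^sup>2 * x 0 = D" using x[of 0] 0 by simp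
    ultimately have "(K s + s\<^sup>2) * e (Suc i) = D * (1 - s\<^sup>2 * X i - (\<Sum>j\<in>UNIV. (H s v* W s) $ j * V i $ j))"
      by (simp add: algebra_simps)
    then show ?thesis
      using nz by (simp add: T_def chain_err_def X_def V_def field_simps)
  qed
  have "x i = x 0 - D * X i \<and> v i = D *s V i" if "i \<le> N" for i
    using that
  proof (induction i)
    case 0
    then show ?case using \<open>v 0 = 0\<close> by (simp add: X_def V_def)
  next
    case (Suc i)
    then have IH: "x i = x 0 - D * X i" "v i = D *s V i" and e': "e (Suc i) = D * T i"
      using step by auto
    have "x (Suc i) = x 0 - D * X (Suc i)"
      using e[of "Suc i"] Suc.prems IH e' by (simp add: X_def T_def chain_state_Suc algebra_simps)
    moreover have "v (Suc i) = D *s V (Suc i)"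
      using v[of "Suc i"] r[of "Suc i"] Suc.prems IH e'
      by (simp add: V_def T_def chain_state_Suc vector_scalar_commute matrix_vector_mul_assoc
          vector_smult_assoc vector_add_ldistrib)
    ultimately show ?case by simp
  qed
  from this[OF less_imp_le[OF i]] have "e (Suc i) = D * T i" using step[OF i] by blast
  then show ?thesis by (simp only: T_def)
qed

section \<open>Continuity of the response in its coefficients\<close>

lemma tendsto_matrix_vector_mult:
  fixes A :: "'a \<Rightarrow> complex^'n^'m"
  assumes "(A \<longlongrightarrow> a) l" "(v \<longlongrightarrow> b) l"
  shows "((\<lambda>x. A x *v v x) \<longlongrightarrow> a *v b) l"
  unfolding matrix_vector_mult_def
  by (intro tendsto_vec_lambda tendsto_sum tendsto_mult tendsto_vec_nth assms)

lemma tendsto_vector_scalar_mult: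
  fixes v :: "'a \<Rightarrow> complex^'n"
  assumes "(c \<longlongrightarrow> a) l" "(v \<longlongrightarrow> b) l"
  shows "((\<lambda>x. c x *s v x) \<longlongrightarrow> a *s b) l"
  unfolding vector_scalar_mult_def
  by (intro tendsto_vec_lambda tendsto_mult tendsto_vec_nth assms)

lemma tendsto_chain_state:
  fixes h F :: "'a \<Rightarrow> complex^'n"
  assumes "(k \<longlongrightarrow> k0) l" "(z \<longlongrightarrow> z0) l" "(h \<longlongrightarrow> h0) l" "(F \<longlongrightarrow> F0) l" "(A \<longlongrightarrow> A0) l" "k0 + z0 \<noteq> 0"
  shows "((\<lambda>s. fst (chain_state (k s) (z s) (h s) (F s) (A s) i)) \<longlongrightarrow> fst (chain_state k0 z0 h0 F0 A0 i)) l \<and>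
    ((\<lambda>s. snd (chain_state (k s) (z s) (h s) (F s) (A s) i)) \<longlongrightarrow> snd (chain_state k0 z0 h0 F0 A0 i)) l \<and>
    ((\<lambda>s. chain_err (k s) (z s) (h s) (F s) (A s) i) \<longlongrightarrow> chain_err k0 z0 h0 F0 A0 i) l"
proof (induction i)
  have err: "((\<lambda>s. chain_err (k s) (z s) (h s) (F s) (A s) i) \<longlongrightarrow> chain_err k0 z0 h0 F0 A0 i) l"
    if "((\<lambda>s. fst (chain_state (k s) (z s) (h s) (F s) (A s) i)) \<longlongrightarrow> fst (chain_state k0 z0 h0 F0 A0 i)) l"
      "((\<lambda>s. snd (chain_state (k s) (z s) (h s) (F s) (A s) i)) \<longlongrightarrow> snd (chain_state k0 z0 h0 F0 A0 i)) l" for i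
    unfolding chain_err_def by (intro tendsto_intros assms that)
  {
    case 0
    show ?case using err[of 0] by simp
  next
    case (Suc i)
    have "((\<lambda>s. fst (chain_state (k s) (z s) (h s) (F s) (A s) (Suc i))) \<longlongrightarrow> fst (chain_state k0 z0 h0 F0 A0 (Suc i))) l"
      unfolding chain_state_Suc by (rule tendsto_add) (use Suc in auto)
    moreover have "((\<lambda>s. snd (chain_state (k s) (z s) (h s) (F s) (A s) (Suc i))) \<longlongrightarrow> snd (chain_state k0 z0 h0 F0 A0 (Suc i))) l"
      unfolding chain_state_Suc
      by (intro tendsto_add tendsto_vector_scalar_mult tendsto_matrix_vector_mult)
        (use Suc assms in auto)
    ultimately show ?case using err by blast
  }
qed

text \<open>The real vector space of matrices has finite dimension, so sufficiently many powers of
  \<open>A\<close> are dependent. This weak form of Cayley-Hamilton yields real coefficients, hence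
  below a real polynomial in the inverse gain.\<close>

lemma matrix_power_dependence:
  fixes A :: "complex^'n^'n"
  obtains q :: "nat \<Rightarrow> real" and n where "\<exists>k\<le>n. q k \<noteq> 0"
    "(\<Sum>k\<le>n. q k *\<^sub>R (((**) A) ^^ k) (mat 1)) = 0"
proof -
  define n where "n = DIM(complex^'n^'n)"
  define B where "B k = (((**) A) ^^ k) (mat 1)" for k
  show ?thesis
  proof (cases "inj_on B {..n}")
    case True
    have "dependent (B ` {..n})"
      by (rule dependent_biggerset) (use True in \<open>simp add: card_image n_def\<close>)
    then obtain u where u: "\<exists>b\<in>B ` {..n}. u b \<noteq> 0" "(\<Sum>b\<in>B ` {..n}. u b *\<^sub>R b) = 0"
      by (auto simp: dependent_finite)
    show ?thesis
    proof (rule that[of n "\<lambda>k. u (B k)"])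
      show "\<exists>k\<le>n. u (B k) \<noteq> 0" using u(1) by auto
      show "(\<Sum>k\<le>n. u (B k) *\<^sub>R (((**) A) ^^ k) (mat 1)) = 0"
        using u(2) sum.reindex[OF True, of "\<lambda>b. u b *\<^sub>R b"] by (simp add: B_def)
    qed
  next
    case False
    then obtain i j where ij: "i \<le> n" "j \<le> n" "i \<noteq> j" "B i = B j"
      by (auto simp: inj_on_def)
    define q :: "nat \<Rightarrow> real" where "q k = (if k = i then 1 else 0) - (if k = j then 1 else 0)" for k
    show ?thesis
    proof (rule that[of n q])
      show "\<exists>k\<le>n. q k \<noteq> 0" using ij by (intro exI[of _ i]) (auto simp: q_def)
      show "(\<Sum>k\<le>n. q k *\<^sub>R (((**) A) ^^ k) (mat 1)) = 0"
        using ij by (simp add: q_def B_def[symmetric] scaleR_left_diff_distrib sum_subtractf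
            if_distrib[of "\<lambda>c. c *\<^sub>R _"] cong: if_cong)
    qed
  qed
qed

section \<open>Static gains and characteristic roots\<close>

lemma scaleR_matrix_vector: "(c *\<^sub>R A) *v w = c *\<^sub>R (A *v w)" for A :: "complex^'n^'m"
  by (simp add: vec_eq_iff matrix_vector_mult_def scaleR_sum_right)

lemma matrix_vector_scaleR: "A *v (c *\<^sub>R w) = c *\<^sub>R (A *v w)" for A :: "complex^'n^'m"
  by (simp add: vec_eq_iff matrix_vector_mult_def scaleR_sum_right)

lemma sum_matrix_vector: "(\<Sum>k\<in>I. M k) *v w = (\<Sum>k\<in>I. M k *v w)" for M :: "'a \<Rightarrow> complex^'n^'m"
  by (induction I rule: infinite_finite_induct) (auto simp: matrix_vector_mult_add_rdistrib)

text \<open>If the errors vanish, the messages asymptotically evolve freely under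
  \<open>c *\<^sub>R A\<close>, while the error equation at \<open>z = 0\<close> forces their sum
  weighted by \<open>c *\<^sub>R h\<close> to tend to \<open>1\<close>. A polynomial relation for
  \<open>A\<close> thus becomes a scalar polynomial equation for \<open>inverse c\<close>, which has
  finitely many solutions.\<close>

lemma finite_gains_vanishing_errors:
  fixes h F :: "complex^'n" and A :: "complex^'n^'n"
  assumes k: "k \<noteq> 0"
  shows "finite {c :: real. c \<noteq> 0 \<and> (chain_err k 0 (c *\<^sub>R h) F (c *\<^sub>R A) \<longlonglongrightarrow> 0)}"
proof -
  obtain q :: "nat \<Rightarrow> real" and n where q: "\<exists>k\<le>n. q k \<noteq> 0"
    and qA: "(\<Sum>k\<le>n. q k *\<^sub>R (((**) A) ^^ k) (mat 1)) = 0"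
    by (rule matrix_power_dependence)
  have "(\<Sum>j\<le>n. q j * inverse c ^ j) = 0"
    if c: "c \<noteq> 0" and lim: "chain_err k 0 (c *\<^sub>R h) F (c *\<^sub>R A) \<longlonglongrightarrow> 0" for c
  proof -
    define B where "B = c *\<^sub>R A"
    define v where "v i = snd (chain_state k 0 (c *\<^sub>R h) F B i)" for i
    define T where "T i = chain_err k 0 (c *\<^sub>R h) F B i" for i
    define y where "y w = (\<Sum>j\<in>UNIV. (c *\<^sub>R h) $ j * w $ j)" for w :: "complex^'n"
    have T: "T \<longlonglongrightarrow> 0" using lim unfolding T_def B_def .
    have v_Suc: "v (Suc i) = T i *s F + B *v v i" for i
      by (simp add: v_def T_def chain_state_Suc)
    have "y (v i) = 1 - k * T i" for i
      using k by (simp add: T_def v_def y_def chain_err_def)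
    then have y_lim: "(\<lambda>i. y (v i)) \<longlonglongrightarrow> 1"
      using tendsto_diff[OF tendsto_const tendsto_mult_left[OF T, of k], of 1] by simp
    \<comment> \<open>The inputs \<open>T\<close> tend to \<open>0\<close>, so over a fixed number
      \<open>j\<close> of steps they disturb the free evolution only by a null sequence.\<close>
    have diff: "(\<lambda>i. v (i + j) - (((*v) B) ^^ j) (v i)) \<longlonglongrightarrow> 0" for j
    proof (induction j)
      case 0
      then show ?case by simp
    next
      case (Suc j)
      have T': "(\<lambda>i. T (i + j)) \<longlonglongrightarrow> 0" using T by (rule LIMSEQ_ignore_initial_segment)
      have "(\<lambda>i. T (i + j) *s F + B *v (v (i + j) - (((*v) B) ^^ j) (v i))) \<longlonglongrightarrow> 0 *s F + B *v 0"
        by (intro tendsto_add tendsto_vector_scalar_mult tendsto_matrix_vector_mult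
            tendsto_const T' Suc)
      then show ?case
        by (simp add: v_Suc matrix_vector_mult_diff_distrib add_diff_eq)
    qed
    \<comment> \<open>Undoing the gain \<open>c\<close> returns the powers of \<open>A\<close>
      itself, so the same coefficients \<open>q\<close> serve for every \<open>c\<close>.\<close>
    have pow: "inverse c ^ j *\<^sub>R (((*v) B) ^^ j) w = (((**) A) ^^ j) (mat 1) *v w" for j w
    proof (induction j)
      case 0
      then show ?case by simp
    next
      case (Suc j)
      have "inverse c ^ Suc j *\<^sub>R (((*v) B) ^^ Suc j) w
          = A *v (inverse c ^ j *\<^sub>R (((*v) B) ^^ j) w)"
        using c by (simp add: B_def scaleR_matrix_vector matrix_vector_scaleR)
      also have "\<dots> = (((**) A) ^^ Suc j) (mat 1) *v w"
        by (subst Suc) (simp add: matrix_vector_mul_assoc)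
      finally show ?case .
    qed
    have y_lin: "y (\<Sum>j\<le>n. r j *\<^sub>R u j) = (\<Sum>j\<le>n. of_real (r j) * y (u j))" for r u
      by (simp add: y_def sum_distrib_left) (subst sum.swap, simp add: mult_ac scaleR_conv_of_real)
    have "(\<lambda>i. \<Sum>j\<le>n. (q j * inverse c ^ j) *\<^sub>R (v (i + j) - (((*v) B) ^^ j) (v i))) \<longlonglongrightarrow>
        (\<Sum>j\<le>n. (q j * inverse c ^ j) *\<^sub>R 0)"
      by (intro tendsto_sum tendsto_scaleR tendsto_const diff)
    moreover have "(\<Sum>j\<le>n. (q j * inverse c ^ j) *\<^sub>R (((*v) B) ^^ j) w) = 0" for w
    proof -
      have "(\<Sum>j\<le>n. (q j * inverse c ^ j) *\<^sub>R (((*v) B) ^^ j) w)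
          = (\<Sum>j\<le>n. q j *\<^sub>R (((**) A) ^^ j) (mat 1)) *v w"
        by (simp add: sum_matrix_vector scaleR_matrix_vector pow[symmetric])
      then show ?thesis by (simp add: qA)
    qed
    ultimately have "(\<lambda>i. \<Sum>j\<le>n. (q j * inverse c ^ j) *\<^sub>R v (i + j)) \<longlonglongrightarrow> 0"
      by (simp add: scaleR_diff_right sum_subtractf)
    then have "(\<lambda>i. y (\<Sum>j\<le>n. (q j * inverse c ^ j) *\<^sub>R v (i + j))) \<longlonglongrightarrow> y 0"
      unfolding y_def by (intro tendsto_sum tendsto_mult tendsto_const tendsto_vec_nth)
    moreover have "(\<lambda>i. y (\<Sum>j\<le>n. (q j * inverse c ^ j) *\<^sub>R v (i + j))) \<longlonglongrightarrow>
        (\<Sum>j\<le>n. of_real (q j * inverse c ^ j) * 1)"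
      unfolding y_lin by (intro tendsto_sum tendsto_mult tendsto_const LIMSEQ_ignore_initial_segment[OF y_lim])
    moreover have "y 0 = 0" by (simp add: y_def)
    ultimately have "of_real (\<Sum>j\<le>n. q j * inverse c ^ j) = (0 :: complex)"
      using LIMSEQ_unique by fastforce
    then show ?thesis by (simp only: of_real_eq_0_iff)
  qed
  then have "{c. c \<noteq> 0 \<and> (chain_err k 0 (c *\<^sub>R h) F (c *\<^sub>R A) \<longlonglongrightarrow> 0)}
      \<subseteq> inverse ` {x. (\<Sum>j\<le>n. q j * x ^ j) = 0}"
    by (auto intro!: image_eqI[where x = "inverse _"])
  moreover have "finite {x. (\<Sum>j\<le>n. q j * x ^ j) = 0}"
    using q polyfun_finite_roots by auto
  ultimately show ?thesis by (blast intro: finite_subset)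
qed

text \<open>Applying (shift - 1)(shift - \<open>A $ 1 $ 1\<close>) to the error equation removes the
  accumulated position and the message, leaving a recurrence of order two with characteristic roots
  \<open>l1\<close> and \<open>l2\<close>. Splitting off \<open>l2\<close> leaves a geometric
  sequence of ratio \<open>l1\<close>, a form that also covers a double root.\<close>

lemma chain_err_scalar:
  fixes h F :: "complex^1" and A :: "complex^1^1"
  assumes nz: "k + z \<noteq> 0"
    and sum: "l1 + l2 = A $ 1 $ 1 + (k - h $ 1 * F $ 1) / (k + z)"
    and prod: "l1 * l2 = (A $ 1 $ 1 * k - h $ 1 * F $ 1) / (k + z)"
  shows "chain_err k z h F A (Suc i) - l2 * chain_err k z h F A i = (l1 - A $ 1 $ 1) * l1 ^ i / (k + z)"
proof -
  define a f where "a = A $ 1 $ 1" and "f = h $ 1 * F $ 1"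
  define X where "X i = fst (chain_state k z h F A i)" for i
  define y where "y i = h $ 1 * snd (chain_state k z h F A i) $ 1" for i
  define T where "T = chain_err k z h F A"
  have T: "(k + z) * T i = 1 - z * X i - y i" for i
    using nz by (simp add: T_def chain_err_def X_def y_def sum_1)
  have X: "X (Suc i) = X i + T i" for i
    by (simp add: X_def T_def chain_state_Suc)
  have y: "y (Suc i) = f * T i + a * y i" for i
    by (simp add: y_def T_def f_def a_def chain_state_Suc matrix_vector_mult_def sum_1 algebra_simps)
  have X0: "X 0 = 0" and y0: "y 0 = 0" by (simp_all add: X_def y_def)
  have sum': "(l1 + l2) * (k + z) = a * (k + z) + k - f"
    using nz by (simp add: sum a_def f_def field_simps)
  have prod': "l1 * l2 * (k + z) = a * k - f"
    using nz by (simp add: prod a_def f_def)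
  have "T (Suc i) - l2 * T i = (l1 - a) * l1 ^ i / (k + z)"
  proof (induction i)
    case 0
    have "(k + z) * T 0 = 1" using T[of 0] by (simp add: X0 y0)
    moreover have "(k + z) * T (Suc 0) = 1 - z * T 0 - f * T 0"
      using T[of "Suc 0"] by (simp add: X y X0 y0)
    ultimately have "(k + z) * T (Suc 0) = (k - f) * T 0" by algebra
    also have "\<dots> = (l1 + l2 - a) * (k + z) * T 0" using sum' by algebra
    finally have "T (Suc 0) = (l1 + l2 - a) * T 0" using nz by simp
    moreover have "T 0 = 1 / (k + z)" using \<open>(k + z) * T 0 = 1\<close> nz by (simp add: field_simps)
    ultimately show ?case using nz by (simp add: field_simps)
  next
    case (Suc i)
    have 1: "(k + z) * T (Suc (Suc i)) = 1 - z * X (Suc (Suc i)) - y (Suc (Suc i))" by (rule T)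
    have "(k + z) * T (Suc (Suc i)) = (a * (k + z) + k - f) * T (Suc i) - (a * k - f) * T i"
      using T[of i] T[of "Suc i"] 1 X[of i] X[of "Suc i"] y[of i] y[of "Suc i"] by algebra
    also have "\<dots> = (k + z) * ((l1 + l2) * T (Suc i) - l1 * l2 * T i)"
      by (simp only: sum'[symmetric] prod'[symmetric]) (simp add: algebra_simps)
    finally have "T (Suc (Suc i)) = (l1 + l2) * T (Suc i) - l1 * l2 * T i" using nz by simp
    then have "T (Suc (Suc i)) - l2 * T (Suc i) = l1 * (T (Suc i) - l2 * T i)"
      by (simp add: algebra_simps)
    then show ?case by (simp add: Suc)
  qed
  then show ?thesis by (simp add: T_def a_def)
qed

text \<open>A fraction of the argument of \<open>c\<close> suffices to bring it into the right half plane, and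
  \<open>m \<ge> 2\<close> makes room for that within \<open>Re w > 0\<close>.\<close>

lemma rotate_into_right_half_plane:
  assumes "c \<noteq> 0" "m \<ge> 2"
  obtains w where "Re w > 0" "Re (c * w ^ m) > 0"
proof -
  \<comment> \<open>Rotation by \<open>m * t\<close> leaves the argument \<open>Arg c / 4\<close>,
    at most \<open>pi / 4\<close> in modulus, while \<open>m \<ge> 2\<close> gives
    \<open>\<bar>t\<bar> \<le> 3 * pi / 8\<close>.\<close>
  define t where "t = - (3 / 4) * Arg c / m"
  have arg: "- pi < Arg c" "Arg c \<le> pi" using mpi_less_Arg Arg_le_pi by auto
  have t_abs: "\<bar>t\<bar> < pi / 2"
  proof -
    have "\<bar>t\<bar> = (3 / 4) * \<bar>Arg c\<bar> / m" using assms by (simp add: t_def abs_mult)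
    also have "\<dots> \<le> (3 / 4) * pi / 2"
      using assms arg by (intro frac_le mult_left_mono) auto
    also have "\<dots> < pi / 2" by simp
    finally show ?thesis .
  qed
  have "c * cis t ^ m = rcis (norm c) (Arg c + m * t)"
  proof -
    have "c = of_real (norm c) * cis (Arg c)"
      using rcis_cmod_Arg[of c] by (simp add: rcis_def)
    from arg_cong[OF this, of "\<lambda>z. z * cis t ^ m"]
    have "c * cis t ^ m = of_real (norm c) * (cis (Arg c) * cis (m * t))"
      by (simp only: Complex.DeMoivre mult.assoc)
    then show ?thesis by (simp only: cis_mult rcis_def)
  qed
  also have "Arg c + m * t = Arg c / 4" using assms by (simp add: t_def)
  finally have "Re (c * cis t ^ m) = norm c * cos (Arg c / 4)" by (simp add: rcis_def)
  moreover have "cos (Arg c / 4) > 0" using arg by (intro cos_gt_zero_pi) auto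
  moreover have "Re (cis t) > 0" using t_abs by (auto intro!: cos_gt_zero_pi)
  ultimately show ?thesis using assms by (intro that[of "cis t"]) auto
qed

text \<open>At a pole, \<open>p\<close> is its order and \<open>g\<close> the regular factor;
  otherwise \<open>K\<close> is continuous at \<open>0\<close> with nonzero value and
  \<open>p = 0\<close> works. Bounded and unbounded \<open>K(0)\<close> can thus be treated together
  in (b).\<close>

lemma transfer_function_near_0:
  assumes K: "transfer_function K" "is_pole K 0 \<or> K 0 \<noteq> 0"
  obtains p g g0 where "(g \<longlongrightarrow> g0) (at 0)" "g0 \<noteq> 0" "\<forall>\<^sub>F s in at 0. K s = g s / s ^ p"
proof (cases "is_pole K 0")
  case True
  have "K meromorphic_on UNIV"
    using K(1) by (simp add: transfer_function_def nicely_meromorphic_on_def)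
  then have "isolated_singularity_at K 0"
    by (simp add: meromorphic_on_altdef)
  then obtain r where r: "r > 0" "K analytic_on ball 0 r - {0}"
    unfolding isolated_singularity_at_def by blast
  from zorder_exist_pole[of K "ball 0 r" 0] r True analytic_imp_holomorphic
  obtain r' where r': "zor_poly K 0 0 \<noteq> 0" "r' > 0" "zor_poly K 0 holomorphic_on cball 0 r'"
    "\<forall>w\<in>cball 0 r' - {0}. K w = zor_poly K 0 w / (w - 0) ^ nat (- zorder K 0)"
    by auto
  have "isCont (zor_poly K 0) 0"
    using r' holomorphic_on_imp_continuous_on continuous_on_interior[of "cball 0 r'"] by force
  moreover have "\<forall>\<^sub>F s in at 0. K s = zor_poly K 0 s / s ^ nat (- zorder K 0)"
    using r' unfolding eventually_at by (intro exI[of _ r']) auto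
  ultimately show ?thesis using r'(1) that isCont_def by blast
next
  case False
  then have "K \<midarrow>0\<rightarrow> K 0" "K 0 \<noteq> 0"
    using K by (auto simp: transfer_function_def nicely_meromorphic_on_def)
  then show ?thesis by (intro that[of K "K 0" 0]) auto
qed

text \<open>Here \<open>A = G W\<close> and \<open>Q = H W F\<close>. Substituting \<open>l = 1 + \<mu>\<close>, the equation for \<open>l1\<close> and \<open>l2\<close> becomes
  \<open>\<mu>\<^sup>2 + b \<mu> + (1 - A) S = 0\<close> with the sensitivity \<open>S = s\<^sup>2 / (K + s\<^sup>2)\<close>, which has at least a double
  zero at \<open>0\<close>. Hence the small root \<open>\<mu>\<close> behaves like \<open>\<kappa> s ^ m\<close> with \<open>m \<ge> 2\<close>, and on a suitable ray
  in the right half plane its real part is positive. The value of \<open>1 / (K + s\<^sup>2)\<close> at \<open>0\<close> is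
  \<open>0 ^ p / g0\<close>, to be read with \<open>0 ^ 0 = 1\<close>.\<close>

lemma unstable_characteristic_root:
  fixes K A Q g :: "complex \<Rightarrow> complex"
  assumes g: "(g \<longlongrightarrow> g0) (at 0)" "g0 \<noteq> 0" and K: "\<forall>\<^sub>F s in at 0. K s = g s / s ^ p"
    and A: "(A \<longlongrightarrow> a0) (at 0)" "a0 \<noteq> 1" and Q: "(Q \<longlongrightarrow> q0) (at 0)"
    and b0: "1 - a0 + q0 * (0 ^ p / g0) \<noteq> 0"
  obtains w where "Re w > 0" and
    "\<forall>\<^sub>F t in at_right (0 :: real). \<forall>s. s = of_real t * w \<longrightarrow> K s + s\<^sup>2 \<noteq> 0 \<and>
      (\<exists>l1 l2. l1 + l2 = A s + (K s - Q s) / (K s + s\<^sup>2) \<and>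
        l1 * l2 = (A s * K s - Q s) / (K s + s\<^sup>2) \<and> norm l1 > 1 \<and> l1 \<noteq> A s)"
proof -
  \<comment> \<open>The order of the zero of the sensitivity: \<open>2\<close> from the double
    integrator and \<open>p\<close> from the pole of \<open>K\<close>.\<close>
  define m where "m = p + 2"
  define D where "D s = g s + s ^ m" for s
  define S where "S s = s ^ m / D s" for s
  define b where "b s = 1 - A s + S s + Q s * (s ^ p / D s)" for s
  \<comment> \<open>Quadratic formula with the principal square root: \<open>r\<close> tends to
    \<open>1\<close>, so \<open>\<mu>\<close> is the root that tends to \<open>0\<close>.\<close>
  define r where "r s = csqrt (1 - 4 * ((1 - A s) * S s) / (b s)\<^sup>2)" for s
  define \<mu> where "\<mu> s = b s * (r s - 1) / 2" for s
  define \<beta> where "\<beta> = 1 - a0 + q0 * (0 ^ p / g0)"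
  \<comment> \<open>Leading coefficient of \<open>- (1 - A s) * S s / b s\<close>, the small root to
    first order.\<close>
  define \<kappa> where "\<kappa> = (a0 - 1) / (g0 * \<beta>)"
  have \<kappa>: "\<kappa> \<noteq> 0" using assms by (simp add: \<kappa>_def \<beta>_def)
  have \<beta>: "\<beta> \<noteq> 0" using b0 by (simp add: \<beta>_def)
  have id: "((\<lambda>s::complex. s) \<longlongrightarrow> 0) (at 0)" by (rule tendsto_ident_at)
  have pow: "((\<lambda>s::complex. s ^ m) \<longlongrightarrow> 0) (at 0)"
    using tendsto_power[OF id, of m] by (simp add: m_def)
  have D: "(D \<longlongrightarrow> g0) (at 0)"
    unfolding D_def using tendsto_add[OF g(1) pow] by simp
  have S: "(S \<longlongrightarrow> 0) (at 0)"
    unfolding S_def using tendsto_divide[OF pow D] g by simp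
  have b: "(b \<longlongrightarrow> \<beta>) (at 0)"
    unfolding b_def \<beta>_def
    using tendsto_add[OF tendsto_add[OF tendsto_diff[OF tendsto_const A(1)] S]
        tendsto_mult[OF Q tendsto_divide[OF tendsto_power[OF id] D g(2)]]] by simp
  have "((\<lambda>s. 1 - 4 * ((1 - A s) * S s) / (b s)\<^sup>2) \<longlongrightarrow> 1 - 4 * ((1 - a0) * 0) / \<beta>\<^sup>2) (at 0)"
    using \<beta> by (intro tendsto_intros A S b) simp
  then have "(r \<longlongrightarrow> csqrt 1) (at 0)"
    unfolding r_def
    by (intro isCont_tendsto_compose[where g = csqrt] continuous_at_csqrt) simp_all
  then have r: "(r \<longlongrightarrow> 1) (at 0)" by simp
  have ev: "\<forall>\<^sub>F s in at 0. s \<noteq> 0 \<and> D s \<noteq> 0 \<and> b s \<noteq> 0 \<and> K s = g s / s ^ p"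
    using K tendsto_imp_eventually_ne[OF D g(2)] tendsto_imp_eventually_ne[OF b \<beta>]
    by (auto simp: eventually_conj_iff eventually_at_filter)
  \<comment> \<open>The principal square root has nonnegative real part, so \<open>1 + r s\<close>
    never vanishes and may be divided by.\<close>
  have "Re (r s) \<ge> 0" for s unfolding r_def by (rule Re_csqrt)
  then have r_neg: "r s \<noteq> -1" for s by (metis not_one_le_zero le_minus_one_simps(3) neg_0_le_iff_le one_complex.simps(1) uminus_complex.simps(1))
  have root: "(\<mu> s)\<^sup>2 + b s * \<mu> s + (1 - A s) * S s = 0" if "b s \<noteq> 0" for s
  proof -
    have "(r s)\<^sup>2 = 1 - 4 * ((1 - A s) * S s) / (b s)\<^sup>2" by (simp add: r_def)
    then have "(b s)\<^sup>2 * (r s)\<^sup>2 = (b s)\<^sup>2 - 4 * ((1 - A s) * S s)"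
      using that by (simp add: field_simps)
    moreover have "2 * \<mu> s = b s * (r s - 1)" by (simp add: \<mu>_def)
    ultimately have "4 * ((\<mu> s)\<^sup>2 + b s * \<mu> s + (1 - A s) * S s) = 0" by algebra
    then show ?thesis by (metis mult_eq_0_iff zero_neq_numeral)
  qed
  \<comment> \<open>Expanding by \<open>1 + r\<close> replaces the vanishing difference
    \<open>r - 1\<close> by \<open>r\<^sup>2 - 1\<close>, which is explicit; the quotient of
    \<open>\<mu>\<close> by \<open>s ^ m\<close> then has an evident limit.\<close>
  have "((\<lambda>s. 2 * ((A s - 1) / D s) / (b s * (1 + r s))) \<longlongrightarrow> 2 * ((a0 - 1) / g0) / (\<beta> * (1 + 1))) (at 0)"
    using \<beta> g by (intro tendsto_intros A D b r) auto
  moreover have "2 * ((a0 - 1) / g0) / (\<beta> * (1 + 1)) = \<kappa>"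
    using \<beta> g(2) by (simp add: \<kappa>_def divide_simps)
  moreover have "\<forall>\<^sub>F s in at 0. 2 * ((A s - 1) / D s) / (b s * (1 + r s)) = \<mu> s / s ^ m"
    using ev
  proof eventually_elim
    case (elim s)
    have "\<mu> s * (2 * (1 + r s)) * b s = (b s)\<^sup>2 * ((r s)\<^sup>2 - 1)"
    proof -
      have "2 * \<mu> s = b s * (r s - 1)" by (simp add: \<mu>_def)
      then show ?thesis by algebra
    qed
    also have "\<dots> = 4 * ((A s - 1) * S s)"
      using elim by (simp add: r_def field_simps)
    finally have "2 * (\<mu> s * (b s * (1 + r s))) = 2 * (2 * ((A s - 1) * S s))" by algebra
    then have "\<mu> s * (b s * (1 + r s)) = 2 * ((A s - 1) * S s)"
      by (metis mult_cancel_left zero_neq_numeral)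
    moreover have "b s * (1 + r s) \<noteq> 0"
      using elim r_neg[of s] by (auto simp: add_eq_0_iff equation_minus_iff)
    ultimately have "\<mu> s = 2 * ((A s - 1) * S s) / (b s * (1 + r s))"
      by (metis nonzero_eq_divide_eq)
    then show ?case using elim by (simp add: S_def)
  qed
  ultimately have \<mu>: "((\<lambda>s. \<mu> s / s ^ m) \<longlongrightarrow> \<kappa>) (at 0)"
    using Lim_transform_eventually by force
  have "((\<lambda>s. b s * (r s - 1) / 2) \<longlongrightarrow> \<beta> * (1 - 1) / 2) (at 0)"
    by (intro tendsto_intros b r) auto
  then have "(\<mu> \<longlongrightarrow> 0) (at 0)" by (simp add: \<mu>_def[abs_def])
  then have "((\<lambda>s. 1 + \<mu> s - A s) \<longlongrightarrow> 1 + 0 - a0) (at 0)" by (intro tendsto_intros A)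
  then have ne: "\<forall>\<^sub>F s in at 0. 1 + \<mu> s \<noteq> A s"
    using tendsto_imp_eventually_ne[of _ "1 + 0 - a0" _ 0] A(2) by force
  obtain w where w: "Re w > 0" "Re (\<kappa> * w ^ m) > 0"
    using rotate_into_right_half_plane[OF \<kappa>, of m] by (auto simp: m_def)
  then have "w \<noteq> 0" by auto
  have "((\<lambda>t. of_real t * w) \<longlongrightarrow> of_real 0 * w) (at_right (0::real))"
    by (intro tendsto_intros)
  moreover have "\<forall>\<^sub>F t in at_right (0::real). of_real t * w \<noteq> 0"
    using \<open>w \<noteq> 0\<close> by (simp add: eventually_at_filter)
  ultimately have ray: "filterlim (\<lambda>t. of_real t * w) (at 0) (at_right (0::real))"
    by (simp add: filterlim_at)
  \<comment> \<open>On the ray, \<open>s ^ m\<close> is \<open>w ^ m\<close> times the positive real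
    \<open>t ^ m\<close>, so multiplying the quotient by \<open>w ^ m\<close> gives a positive
    multiple of \<open>\<mu>\<close>.\<close>
  have "((\<lambda>t. Re (\<mu> (of_real t * w) / (of_real t * w) ^ m * w ^ m)) \<longlongrightarrow> Re (\<kappa> * w ^ m)) (at_right (0::real))"
    by (intro tendsto_intros filterlim_compose[OF \<mu> ray])
  then have "\<forall>\<^sub>F t in at_right (0::real). Re (\<mu> (of_real t * w) / (of_real t * w) ^ m * w ^ m) > 0"
    using w(2) order_tendstoD(1) by blast
  moreover have "\<forall>\<^sub>F t in at_right (0::real). t > 0" by (simp add: eventually_at_filter)
  ultimately have re: "\<forall>\<^sub>F t in at_right (0::real). Re (\<mu> (of_real t * w)) > 0"
  proof eventually_elim
    case (elim t)
    have "\<mu> (of_real t * w) / (of_real t * w) ^ m * w ^ m = \<mu> (of_real t * w) / of_real (t ^ m)"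
      using \<open>w \<noteq> 0\<close> by (simp add: power_mult_distrib)
    with elim have "Re (\<mu> (of_real t * w)) / t ^ m > 0" by (simp only: Re_divide_of_real)
    then show ?case using elim by (simp add: zero_less_divide_iff)
  qed
  have "\<forall>\<^sub>F t in at_right (0 :: real). \<forall>s. s = of_real t * w \<longrightarrow> K s + s\<^sup>2 \<noteq> 0 \<and>
      (\<exists>l1 l2. l1 + l2 = A s + (K s - Q s) / (K s + s\<^sup>2) \<and>
        l1 * l2 = (A s * K s - Q s) / (K s + s\<^sup>2) \<and> norm l1 > 1 \<and> l1 \<noteq> A s)"
    using re eventually_compose_filterlim[OF ev ray] eventually_compose_filterlim[OF ne ray]
  proof eventually_elim
    case (elim t)
    define s where "s = of_real t * w"
    note elim = elim[folded s_def]
    have P: "K s + s\<^sup>2 = D s / s ^ p"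
      using elim by (simp add: D_def m_def field_simps power_add power2_eq_square)
    define R where "R = 1 / (K s + s\<^sup>2)"
    have R: "R = s ^ p / D s" by (simp add: R_def P)
    have nz: "K s + s\<^sup>2 \<noteq> 0" using P elim by simp
    have SR: "S s = s\<^sup>2 * R" by (simp add: S_def R m_def power_add power2_eq_square)
    have KR: "K s * R = 1 - s\<^sup>2 * R" using nz by (simp add: R_def field_simps)
    have b': "b s = 1 - A s + s\<^sup>2 * R + Q s * R" by (simp add: b_def SR R)
    define l1 l2 where "l1 = 1 + \<mu> s" and "l2 = A s + (K s - Q s) * R - l1"
    have "l1 * l2 = (A s * K s - Q s) * R"
    proof -
      have l2: "l2 = A s - s\<^sup>2 * R - Q s * R - \<mu> s" using KR by (simp add: l1_def l2_def algebra_simps)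
      have "(A s * K s - Q s) * R = A s - A s * (s\<^sup>2 * R) - Q s * R"
        using KR by algebra
      moreover have "l1 * l2 = A s - A s * (s\<^sup>2 * R) - Q s * R"
        using root[of s] elim unfolding l1_def l2 b' SR by algebra
      ultimately show ?thesis by simp
    qed
    moreover have "l1 + l2 = A s + (K s - Q s) * R" by (simp add: l2_def)
    moreover have "norm l1 > 1"
      using elim complex_Re_le_cmod[of l1] by (simp add: l1_def)
    moreover have "l1 \<noteq> A s" using elim by (simp add: l1_def)
    ultimately show ?case using nz by (auto simp: s_def[symmetric] R_def)
  qed
  with w(1) show ?thesis by (rule that)
qed

section \<open>Perturbations of the channel\<close>

text \<open>Each exceptional set is discrete, hence countable, and so is their union, whereas a
  segment of the ray is not. The exceptional points of a response may vary with \<open>N\<close>,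
  but one point has to serve all chain lengths.\<close>

lemma avoid_exceptional_points_on_ray:
  fixes P :: "nat \<Rightarrow> complex \<Rightarrow> bool"
  assumes P: "\<And>n. \<forall>\<^sub>\<approx>s\<in>{s. Re s > 0}. P n s" and w: "Re w > 0" and ab: "0 \<le> a" "a < b"
  obtains t where "a < t" "t < b" "\<And>n. P n (of_real t * w)"
proof -
  have "countable ({s. Re s > 0} \<inter> {s. \<not> P n s})" for n
    by (rule sparse_imp_countable)
      (use P[of n] in \<open>simp_all add: open_halfspace_Re_gt eventually_cosparse\<close>)
  then have C: "countable (\<Union>n. {s. Re s > 0} \<inter> {s. \<not> P n s})" (is "countable ?X")
    by (rule countable_UN[OF countableI_type])
  have inj: "inj_on (\<lambda>t. of_real t * w) {a<..<b}"
    using w by (auto simp: inj_on_def)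
  have "\<not> (\<lambda>t. of_real t * w) ` {a<..<b} \<subseteq> ?X"
  proof
    assume "(\<lambda>t. of_real t * w) ` {a<..<b} \<subseteq> ?X"
    then have "countable {a<..<b}"
      using C countable_subset countable_image_inj_on[OF _ inj] by metis
    then show False using ab uncountable_open_interval[of a b] by simp
  qed
  then obtain t where "t \<in> {a<..<b}" "of_real t * w \<notin> ?X" by blast
  then show ?thesis using ab w by (intro that[of t]) auto
qed

text \<open>The value at a pole has to stay \<open>0\<close> to keep
  \<open>nicely_meromorphic_on\<close>, hence the case distinction. The constant moves no pole,
  respects conjugation because it is real, and is absorbed by the growth bound.\<close>

lemma stable_add_const:
  assumes f: "stable f" and c: "cnj c = c"
  shows "stable (\<lambda>s. if is_pole f s then 0 else f s + c)" (is "stable ?g")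
proof -
  have nm: "f nicely_meromorphic_on UNIV" and sym: "\<And>s. f (cnj s) = cnj (f s)" and "causal f"
    and poles: "\<And>s. is_pole f s \<Longrightarrow> Re s < 0"
    using f by (auto simp: stable_def transfer_function_def)
  have mero: "f meromorphic_on UNIV" using nm by (simp add: nicely_meromorphic_on_def)
  have ev: "\<forall>\<^sub>F s in at z. ?g s = f s + c" for z
  proof -
    have "isolated_singularity_at f z" using mero by (simp add: meromorphic_on_altdef)
    then have "\<forall>\<^sub>F s in at z. \<not> is_pole f s" by (rule eventually_not_pole)
    then show ?thesis by eventually_elim simp
  qed
  have pole: "is_pole ?g z \<longleftrightarrow> is_pole f z" for z
    using is_pole_cong[OF ev refl] is_pole_plus_const_iff[of f z c] by simp
  have "(\<lambda>s. f s + c) meromorphic_on UNIV" using mero by (intro meromorphic_intros)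
  then have "?g meromorphic_on UNIV"
    using meromorphic_on_cong[OF ev refl] by blast
  moreover have "?g \<midarrow>z\<rightarrow> ?g z" if "\<not> is_pole f z" for z
  proof -
    have "f \<midarrow>z\<rightarrow> f z" using nm that by (auto simp: nicely_meromorphic_on_def)
    then have "(\<lambda>s. f s + c) \<midarrow>z\<rightarrow> f z + c" by (intro tendsto_intros)
    then show ?thesis using that tendsto_cong[OF ev] by simp
  qed
  ultimately have "?g nicely_meromorphic_on UNIV"
    by (auto simp: nicely_meromorphic_on_def pole)
  moreover have "?g (cnj s) = cnj (?g s)" for s
  proof -
    \<comment> \<open>The pole set must be symmetric under conjugation for the case distinction in
      \<open>?g\<close> to respect the symmetry.\<close>
    have *: "is_pole f (cnj s)" if "is_pole f s" for s
    proof -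
      have "filterlim (\<lambda>z. cnj (f z)) at_infinity (at s)"
        using that by (simp add: is_pole_def filterlim_at_infinity_conv_norm_at_top)
      moreover have "filterlim cnj (at s) (at (cnj s))"
        using tendsto_cnj[OF tendsto_ident_at, of "cnj s" UNIV]
        by (auto simp: filterlim_at eventually_at_filter complex_cnj_cancel_iff[of _ "cnj s", simplified])
      ultimately have "filterlim (\<lambda>z. cnj (f (cnj z))) at_infinity (at (cnj s))"
        by (rule filterlim_compose)
      then show ?thesis by (simp add: is_pole_def sym)
    qed
    show ?thesis using *[of s] *[of "cnj s"] sym c by auto
  qed
  moreover have "causal ?g"
  proof -
    obtain \<sigma> C and m :: nat where *: "\<And>s. Re s > \<sigma> \<Longrightarrow> \<not> is_pole f s \<and> norm (f s) \<le> C * (1 + norm s) ^ m"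
      using \<open>causal f\<close> unfolding causal_def by blast
    have "norm (?g s) \<le> (C + norm c) * (1 + norm s) ^ m" if "Re s > \<sigma>" for s
    proof -
      have "norm (f s + c) \<le> C * (1 + norm s) ^ m + norm c * 1"
        using *[OF that] norm_triangle_ineq[of "f s" c] by linarith
      also have "\<dots> \<le> C * (1 + norm s) ^ m + norm c * (1 + norm s) ^ m"
        by (intro add_left_mono mult_left_mono one_le_power) auto
      finally show ?thesis using *[OF that] by (simp add: algebra_simps)
    qed
    then show ?thesis using * unfolding causal_def pole by blast
  qed
  ultimately show ?thesis using poles by (simp add: stable_def transfer_function_def pole)
qed

lemma stable_tendsto_0: "stable f \<Longrightarrow> (f \<longlongrightarrow> f 0) (at 0)"
  by (force simp: stable_def transfer_function_def nicely_meromorphic_on_def)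

lemma stable_vec_tendsto_0: "stable_vec f \<Longrightarrow> (f \<longlongrightarrow> f 0) (at 0)"
  by (intro vec_tendstoI stable_tendsto_0) (auto simp: stable_vec_def)

lemma stable_mat_tendsto_0: "stable_mat f \<Longrightarrow> (f \<longlongrightarrow> f 0) (at 0)"
  by (intro vec_tendstoI stable_tendsto_0) (auto simp: stable_mat_def)

text \<open>The perturbation is by a constant matrix, since \<open>(1 + \<delta>) W\<close> need not be close to \<open>W\<close>:
  an admissible channel may be unbounded in the right half plane.\<close>

lemma robustly_change_of_gain:
  assumes rob: "robustly P W" and W: "admissible_channel W"
  obtains \<delta>0 where "\<delta>0 > 0"
    "\<And>\<delta>. \<bar>\<delta>\<bar> < \<delta>0 \<Longrightarrow> \<exists>W'. P W' \<and> (W' \<longlongrightarrow> (1 + \<delta>) *\<^sub>R W 0) (at 0)"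
proof -
  obtain \<epsilon> where \<epsilon>: "\<epsilon> > 0"
    and P: "\<And>W'. admissible_channel W' \<Longrightarrow> (\<And>s. Re s \<ge> 0 \<Longrightarrow> norm (W' s - W s) \<le> \<epsilon>) \<Longrightarrow> P W'"
    using rob unfolding robustly_def by blast
  have st: "stable (\<lambda>s. W s $ i $ j)" for i j
    using W by (simp add: admissible_channel_def stable_mat_def)
  obtain B where B: "\<And>\<omega>. norm (W (\<i> * of_real \<omega>)) \<le> B"
    using W by (auto simp: admissible_channel_def bounded_on_imaginary_axis_def)
  have "\<exists>W'. P W' \<and> (W' \<longlongrightarrow> (1 + \<delta>) *\<^sub>R W 0) (at 0)"
    if \<delta>: "\<bar>\<delta>\<bar> < \<epsilon> / (1 + norm (W 0))" for \<delta>
  proof -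
    define W' where "W' s = (\<chi> i j. if is_pole (\<lambda>s. W s $ i $ j) s then 0 else W s $ i $ j + of_real \<delta> * (W 0 $ i $ j))" for s
    have eq: "W' s = W s + \<delta> *\<^sub>R W 0" if "Re s \<ge> 0" for s
      using st that unfolding W'_def vec_eq_iff stable_def
      by (auto simp: scaleR_conv_of_real[where 'a = complex] dest: leD)
    have "cnj (W 0 $ i $ j) = W 0 $ i $ j" for i j
      using st[of i j] unfolding stable_def transfer_function_def by (metis complex_cnj_zero)
    then have "stable (\<lambda>s. W' s $ i $ j)" for i j
      unfolding W'_def using stable_add_const[OF st[of i j], of "of_real \<delta> * (W 0 $ i $ j)"] by simp
    then have st': "stable_mat W'" by (simp add: stable_mat_def)
    have "norm (W' (\<i> * of_real \<omega>)) \<le> B + norm (\<delta> *\<^sub>R W 0)" for \<omega>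
      using norm_triangle_ineq[of "W (\<i> * of_real \<omega>)" "\<delta> *\<^sub>R W 0"] B[of \<omega>] by (simp add: eq)
    then have "admissible_channel W'"
      using st' by (auto simp: admissible_channel_def bounded_on_imaginary_axis_def)
    moreover have "norm (W' s - W s) \<le> \<epsilon>" if "Re s \<ge> 0" for s
    proof -
      have "norm (W' s - W s) = \<bar>\<delta>\<bar> * norm (W 0)" using that by (simp add: eq)
      also have "\<dots> \<le> \<bar>\<delta>\<bar> * (1 + norm (W 0))" by (simp add: mult_left_mono)
      also have "\<dots> \<le> \<epsilon>" using \<delta> by (simp add: pos_less_divide_eq add_pos_nonneg)
      finally show ?thesis .
    qed
    ultimately have "P W'" by (rule P)
    moreover have "W' 0 = (1 + \<delta>) *\<^sub>R W 0" by (simp add: eq scaleR_left_distrib)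
    ultimately show ?thesis using stable_mat_tendsto_0[OF st'] by auto
  qed
  moreover have "\<epsilon> / (1 + norm (W 0)) > 0" using \<epsilon> by (simp add: add_pos_nonneg)
  ultimately show ?thesis using that by blast
qed

section \<open>Consequences of string stability\<close>

text \<open>The errors have the Laplace transform of the pulse times the unit response as their own
  transform, and Cauchy-Schwarz bounds that pointwise by their \<open>L2_norm\<close>.\<close>

lemma chain_response_leader_step:
  fixes F :: "complex \<Rightarrow> complex^'n" and H :: "complex \<Rightarrow> complex^'m"
  assumes resp: "chain_response K H F G W N (\<lambda>i. if i = 0 then indicator {0..b} else (\<lambda>t. 0)) e"
    and b: "b > 0"
  shows "\<forall>\<^sub>\<approx>s\<in>{s. Re s > 0}. K s + s\<^sup>2 \<noteq> 0 \<longrightarrow> (\<forall>i<N.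
    norm ((1 - exp (- s * of_real b)) / s * chain_err (K s) (s\<^sup>2) (H s v* W s) (F s) (G s ** W s) i) \<le>
      L2_norm (e (Suc i)) / sqrt (2 * Re s))"
proof -
  have "\<forall>\<^sub>\<approx>s\<in>{s. Re s > 0}. chain_eqs K H F G W N s
      (\<lambda>i. laplace (if i = 0 then indicator {0..b} else (\<lambda>t. 0)) s) (\<lambda>i. laplace (e i) s)"
    using resp by (simp add: chain_response_def)
  moreover have "\<forall>\<^sub>\<approx>s\<in>{s. Re s > 0}. s \<in> {s. Re s > 0}"
    by (rule eventually_in_cosparse) (auto simp: open_halfspace_Re_gt)
  ultimately show ?thesis
  proof eventually_elim
    case (elim s)
    then have s: "s \<noteq> 0" "Re s > 0" by auto
    have "(\<lambda>i. laplace (if i = 0 then indicator {0..b} else (\<lambda>t. 0)) s)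
        = (\<lambda>i. if i = 0 then (1 - exp (- s * of_real b)) / s else 0)"
      using s b by (auto simp: laplace_indicator)
    note D = this
    from elim have eqs: "chain_eqs K H F G W N s (\<lambda>i. if i = 0 then (1 - exp (- s * of_real b)) / s else 0)
        (\<lambda>i. laplace (e i) s)" by (simp only: D)
    show ?case
    proof (intro impI allI)
      fix i assume nz: "K s + s\<^sup>2 \<noteq> 0" and i: "i < N"
      have "L2_signal (e (Suc i))" using resp i by (auto simp: chain_response_def)
      from norm_laplace_le[OF this s(2)]
      have "norm (laplace (e (Suc i)) s) \<le> sqrt ((L2_norm (e (Suc i)))\<^sup>2 / (2 * Re s))"
        by (rule real_le_rsqrt)
      also have "\<dots> = L2_norm (e (Suc i)) / sqrt (2 * Re s)"
        by (simp add: real_sqrt_divide L2_norm_def)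
      finally show "norm ((1 - exp (- s * of_real b)) / s *
          chain_err (K s) (s\<^sup>2) (H s v* W s) (F s) (G s ** W s) i) \<le> L2_norm (e (Suc i)) / sqrt (2 * Re s)"
        using chain_eqs_imp_chain_err[OF eqs nz i] by simp
    qed
  qed
qed

text \<open>The bound on the signals is uniform in \<open>N\<close> and \<open>k\<close>, so at a
  point avoiding all exceptional sets it bounds every error at once; \<open>B\<close> may depend on
  the point but not on \<open>i\<close>.\<close>

lemma L2_string_stable_imp_bounded_errors:
  fixes F :: "complex \<Rightarrow> complex^'n" and H :: "complex \<Rightarrow> complex^'m"
  assumes st: "L2_string_stable K H F G W" and w: "Re w > 0" and ab: "0 \<le> a" "a < b"
  shows "\<exists>t B. a < t \<and> t < b \<and> (\<forall>s i. s = of_real t * w \<longrightarrow> K s + s\<^sup>2 \<noteq> 0 \<longrightarrow>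
    norm (chain_err (K s) (s\<^sup>2) (H s v* W s) (F s) (G s ** W s) i) \<le> B)"
proof -
  define d :: "nat \<Rightarrow> real \<Rightarrow> real" where "d = (\<lambda>i. if i = 0 then indicator {0..1} else (\<lambda>t. 0))"
  obtain c where "\<forall>N d. \<forall>i\<in>{0..N}. L2_signal (d i) \<and> (\<forall>j. j \<noteq> i \<longrightarrow> d j = (\<lambda>t. 0)) \<longrightarrow>
        (\<exists>e. chain_response K H F G W N d e \<and> (\<forall>k\<in>{1..N}. L2_norm (e k) \<le> c * L2_norm (d i)))"
    using st unfolding L2_string_stable_def by blast
  from this[rule_format, of 0 _ d] have "\<exists>e. chain_response K H F G W N d e \<and> (\<forall>k\<in>{1..N}. L2_norm (e k) \<le> c)" for N
    by (auto simp: d_def L2_signal_indicator L2_norm_indicator)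
  then obtain e where e: "\<And>N. chain_response K H F G W N d (e N)"
    "\<And>N k. k \<in> {1..N} \<Longrightarrow> L2_norm (e N k) \<le> c"
    by metis
  define P where "P N s \<longleftrightarrow> (K s + s\<^sup>2 \<noteq> 0 \<longrightarrow> (\<forall>i<N.
      norm ((1 - exp (- s * of_real 1)) / s * chain_err (K s) (s\<^sup>2) (H s v* W s) (F s) (G s ** W s) i)
        \<le> L2_norm (e N (Suc i)) / sqrt (2 * Re s)))" for N s
  have "\<forall>\<^sub>\<approx>s\<in>{s. Re s > 0}. P N s" for N
    unfolding P_def using e(1)[of N, unfolded d_def] by (rule chain_response_leader_step) simp
  then obtain t where t: "a < t" "t < b" and bound: "\<And>N. P N (of_real t * w)"
    using w ab by (rule avoid_exceptional_points_on_ray[of P w a b]) blast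
  define s where "s = of_real t * w"
  have Re: "Re s > 0" using t ab w by (simp add: s_def)
  then have s: "s \<noteq> 0" by auto
  define D where "D = (1 - exp (- s)) / s"
  have "norm (exp (- s)) \<noteq> 1" using Re by (simp add: norm_exp_eq_Re)
  then have "exp (- s) \<noteq> 1" by (metis norm_one)
  then have D: "D \<noteq> 0" using s by (auto simp: D_def)
  have "norm (chain_err (K s) (s\<^sup>2) (H s v* W s) (F s) (G s ** W s) i) \<le> c / sqrt (2 * Re s) / norm D"
    if "K s + s\<^sup>2 \<noteq> 0" for i
  proof -
    have "norm (D * chain_err (K s) (s\<^sup>2) (H s v* W s) (F s) (G s ** W s) i)
        \<le> L2_norm (e (Suc i) (Suc i)) / sqrt (2 * Re s)"
      using bound[of "Suc i"] that by (simp add: P_def s_def[symmetric] D_def)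
    also have "\<dots> \<le> c / sqrt (2 * Re s)"
      using e(2)[of "Suc i" "Suc i"] Re by (intro divide_right_mono) auto
    finally have "norm (chain_err (K s) (s\<^sup>2) (H s v* W s) (F s) (G s ** W s) i) * norm D \<le> c / sqrt (2 * Re s)"
      by (simp only: norm_mult mult.commute)
    then show ?thesis using D by (simp add: pos_le_divide_eq del: divide_divide_eq_left)
  qed
  with t show ?thesis unfolding s_def by blast
qed

text \<open>Steps of duration \<open>b\<close> at the leader test the chain at frequencies of order \<open>1 / b\<close>, at which
  their Laplace transform is of order \<open>b\<close>; hence the bound is uniform as \<open>s \<rightarrow> 0\<close>.\<close>

lemma L2_l2_string_stable_imp_static_bound:
  fixes F :: "complex \<Rightarrow> complex^'n" and H :: "complex \<Rightarrow> complex^'m"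
  assumes st: "L2_l2_string_stable K H F G W"
    and K: "(K \<longlongrightarrow> k0) (at 0)" "k0 \<noteq> 0" and H: "(H \<longlongrightarrow> h0) (at 0)" and F: "(F \<longlongrightarrow> f0) (at 0)"
    and G: "(G \<longlongrightarrow> g0) (at 0)" and W: "(W \<longlongrightarrow> w0) (at 0)"
  shows "\<exists>C. \<forall>N. (\<Sum>i<N. (norm (chain_err k0 0 (h0 v* w0) f0 (g0 ** w0) i))\<^sup>2) \<le> C"
proof -
  obtain c where c: "\<forall>N d. (\<forall>i\<in>{0..N}. L2_signal (d i)) \<longrightarrow>
        (\<exists>e. chain_response K H F G W N d e \<and> L2_l2_norm {1..N} e \<le> c * L2_l2_norm {0..N} d)"
    using st unfolding L2_l2_string_stable_def by blast
  define \<gamma> where "\<gamma> = 1 - exp (-1 :: real)"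
  have \<gamma>: "\<gamma> > 0" by (simp add: \<gamma>_def)
  define T where "T s i = chain_err (K s) (s\<^sup>2) (H s v* W s) (F s) (G s ** W s) i" for s i
  define T0 where "T0 i = chain_err k0 0 (h0 v* w0) f0 (g0 ** w0) i" for i
  \<comment> \<open>For a pulse of duration \<open>1 / a\<close> and \<open>a < s < 2 * a\<close>,
    the factor \<open>\<gamma>\<close> bounds \<open>1 - exp (- s / a)\<close> from below; the pulse
    energy and the Laplace bound then combine so that \<open>a\<close> drops out, and the bound
    survives \<open>a \<rightarrow> 0\<close>.\<close>
  have bound: "\<exists>s. a < s \<and> s < 2 * a \<and> (K (of_real s) + (of_real s)\<^sup>2 \<noteq> 0 \<longrightarrow>
      (\<Sum>i<N. (norm (T (of_real s) i))\<^sup>2) \<le> c\<^sup>2 / \<gamma>\<^sup>2)" if a: "a > 0" for a N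
  proof -
    define b where "b = 1 / a"
    have b: "b > 0" using a by (simp add: b_def)
    define d :: "nat \<Rightarrow> real \<Rightarrow> real" where "d = (\<lambda>i. if i = 0 then indicator {0..b} else (\<lambda>t. 0))"
    have "\<forall>i\<in>{0..N}. L2_signal (d i)" by (simp add: d_def L2_signal_indicator)
    with c obtain e where e: "chain_response K H F G W N d e"
      and le: "L2_l2_norm {1..N} e \<le> c * L2_l2_norm {0..N} d" by blast
    have sq: "(L2_l2_norm I f)\<^sup>2 = (\<Sum>i\<in>I. (L2_norm (f i))\<^sup>2)" for I f
      by (simp add: L2_l2_norm_def L2_norm_def sum_nonneg)
    have "(L2_l2_norm {0..N} d)\<^sup>2 = (\<Sum>i\<in>{0..N}. if i = 0 then b else 0)"
      unfolding sq using b by (intro sum.cong) (auto simp: d_def L2_norm_indicator, simp add: L2_norm_def)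
    then have d2: "(L2_l2_norm {0..N} d)\<^sup>2 = b" by simp
    have "L2_l2_norm {1..N} e \<ge> 0" by (simp add: L2_l2_norm_def sum_nonneg)
    then have "(L2_l2_norm {1..N} e)\<^sup>2 \<le> (c * L2_l2_norm {0..N} d)\<^sup>2"
      using le by (intro power_mono)
    then have e2: "(\<Sum>i<N. (L2_norm (e (Suc i)))\<^sup>2) \<le> c\<^sup>2 * b"
      by (simp add: sq power_mult_distrib d2[unfolded sq] sum.atLeast1_atMost_eq)
    define P where "P s \<longleftrightarrow> (K s + s\<^sup>2 \<noteq> 0 \<longrightarrow> (\<forall>i<N.
        norm ((1 - exp (- s * of_real b)) / s * T s i) \<le> L2_norm (e (Suc i)) / sqrt (2 * Re s)))" for s
    have "\<forall>\<^sub>\<approx>s\<in>{s. Re s > 0}. P s"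
      unfolding P_def T_def using e[unfolded d_def] b by (rule chain_response_leader_step)
    then obtain s where s: "a < s" "s < 2 * a" and "P (of_real s * 1)"
      by (rule avoid_exceptional_points_on_ray[of "\<lambda>_. P" 1 a "2 * a"]) (use a in auto)
    then have T: "K (of_real s) + (of_real s)\<^sup>2 \<noteq> 0 \<longrightarrow> (\<forall>i<N.
        norm ((1 - exp (- of_real s * of_real b)) / of_real s * T (of_real s) i) \<le> L2_norm (e (Suc i)) / sqrt (2 * s))"
      by (simp add: P_def)
    have "(\<Sum>i<N. (norm (T (of_real s) i))\<^sup>2) \<le> c\<^sup>2 / \<gamma>\<^sup>2" if nz: "K (of_real s) + (of_real s)\<^sup>2 \<noteq> 0"
    proof -
      have s0: "s > 0" using s a by simp
      have sb: "s * b > 1" "s * b < 2" using s a by (simp_all add: b_def field_simps)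
      have "\<gamma> \<le> 1 - exp (- (s * b))" using sb by (simp add: \<gamma>_def)
      also have "\<dots> \<le> norm (1 - exp (- of_real s * of_real b) :: complex)"
        using norm_triangle_ineq2[of "1 :: complex" "exp (- of_real s * of_real b)"] by (simp add: norm_exp_eq_Re)
      finally have D: "\<gamma> / s \<le> norm ((1 - exp (- of_real s * of_real b)) / of_real s :: complex)"
        using s0 by (simp add: norm_divide divide_right_mono)
      have "(\<gamma> / s)\<^sup>2 * (norm (T (of_real s) i))\<^sup>2 \<le> (L2_norm (e (Suc i)))\<^sup>2 / (2 * s)" if "i < N" for i
      proof -
        have "\<gamma> / s * norm (T (of_real s) i) \<le> norm ((1 - exp (- of_real s * of_real b)) / of_real s :: complex) * norm (T (of_real s) i)"
          using D by (intro mult_right_mono) auto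
        also have "\<dots> \<le> L2_norm (e (Suc i)) / sqrt (2 * s)"
          using T[rule_format, OF nz that] by (simp only: norm_mult)
        finally have "(\<gamma> / s * norm (T (of_real s) i))\<^sup>2 \<le> (L2_norm (e (Suc i)) / sqrt (2 * s))\<^sup>2"
          using \<gamma> s0 by (intro power_mono) auto
        then show ?thesis using s0 by (simp add: power_mult_distrib power_divide)
      qed
      then have "(\<Sum>i<N. (\<gamma> / s)\<^sup>2 * (norm (T (of_real s) i))\<^sup>2) \<le> (\<Sum>i<N. (L2_norm (e (Suc i)))\<^sup>2 / (2 * s))"
        by (intro sum_mono) auto
      then have "(\<gamma> / s)\<^sup>2 * (\<Sum>i<N. (norm (T (of_real s) i))\<^sup>2) \<le> (\<Sum>i<N. (L2_norm (e (Suc i)))\<^sup>2) / (2 * s)"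
        by (simp add: sum_distrib_left sum_divide_distrib)
      also have "\<dots> \<le> c\<^sup>2 * b / (2 * s)" using e2 s0 by (intro divide_right_mono) auto
      finally have "\<gamma>\<^sup>2 * (\<Sum>i<N. (norm (T (of_real s) i))\<^sup>2) \<le> s\<^sup>2 * (c\<^sup>2 * b / (2 * s))"
        using s0 by (simp add: power_divide field_simps)
      also have "\<dots> = c\<^sup>2 * ((s * b) / 2)" using s0 by (simp add: power2_eq_square)
      also have "\<dots> \<le> c\<^sup>2 * 1" using sb by (intro mult_left_mono) auto
      finally show ?thesis using \<gamma> by (simp add: pos_le_divide_eq mult.commute)
    qed
    then show ?thesis using s by blast
  qed
  have lim2: "((\<lambda>s::complex. s\<^sup>2) \<longlongrightarrow> 0) (at 0)"
    using tendsto_power[OF tendsto_ident_at, of 2 "0::complex"] by simp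
  have HW: "((\<lambda>s. H s v* W s) \<longlongrightarrow> h0 v* w0) (at 0)"
    unfolding vector_matrix_mult_def
    by (intro tendsto_vec_lambda tendsto_sum tendsto_mult tendsto_vec_nth H W)
  have GW: "((\<lambda>s. G s ** W s) \<longlongrightarrow> g0 ** w0) (at 0)"
    unfolding matrix_matrix_mult_def
    by (intro tendsto_vec_lambda tendsto_sum tendsto_mult tendsto_vec_nth G W)
  have T_lim: "((\<lambda>s. T s i) \<longlongrightarrow> T0 i) (at 0)" for i
    unfolding T_def T0_def using tendsto_chain_state[OF K(1) lim2 HW F GW] K(2) by simp
  have "(\<Sum>i<N. (norm (T0 i))\<^sup>2) \<le> c\<^sup>2 / \<gamma>\<^sup>2" for N
  proof (rule ccontr)
    \<comment> \<open>A violation at \<open>0\<close> would persist by continuity in a punctured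
      disc of radius \<open>r\<close>, but \<open>bound\<close> provides a point between
      \<open>r / 2\<close> and \<open>r\<close> without it.\<close>
    assume *: "\<not> ?thesis"
    have "((\<lambda>s. \<Sum>i<N. (norm (T s i))\<^sup>2) \<longlongrightarrow> (\<Sum>i<N. (norm (T0 i))\<^sup>2)) (at 0)"
      by (intro tendsto_intros T_lim)
    then have "\<forall>\<^sub>F s in at 0. (\<Sum>i<N. (norm (T s i))\<^sup>2) > c\<^sup>2 / \<gamma>\<^sup>2"
      using * by (intro order_tendstoD(1)) auto
    moreover have "\<forall>\<^sub>F s in at 0. K s + s\<^sup>2 \<noteq> 0"
      using tendsto_imp_eventually_ne[OF tendsto_add[OF K(1) lim2], of 0] K(2) by simp
    ultimately have "\<forall>\<^sub>F s in at 0. (\<Sum>i<N. (norm (T s i))\<^sup>2) > c\<^sup>2 / \<gamma>\<^sup>2 \<and> K s + s\<^sup>2 \<noteq> 0"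
      by (rule eventually_conj)
    then obtain r where r: "r > 0" "\<And>s. s \<noteq> 0 \<Longrightarrow> norm s < r \<Longrightarrow>
        (\<Sum>i<N. (norm (T s i))\<^sup>2) > c\<^sup>2 / \<gamma>\<^sup>2 \<and> K s + s\<^sup>2 \<noteq> 0"
      by (auto simp: eventually_at)
    obtain s where s: "r / 2 < s" "s < 2 * (r / 2)" "K (of_real s) + (of_real s)\<^sup>2 \<noteq> 0 \<longrightarrow>
      (\<Sum>i<N. (norm (T (of_real s) i))\<^sup>2) \<le> c\<^sup>2 / \<gamma>\<^sup>2"
      using bound[of "r / 2" N] r(1) by auto
    show False using r(2)[of "of_real s"] s r(1) by auto
  qed
  then show ?thesis unfolding T0_def by blast
qed

text \<open>For a disturbance with a single nonzero component both norms agree, and each error is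
  dominated by the combined one; the constant carries over.\<close>

lemma L2_l2_string_stable_imp_L2_string_stable:
  assumes "L2_l2_string_stable K H F G W"
  shows "L2_string_stable K H F G W"
proof -
  obtain c where c: "\<forall>N d. (\<forall>i\<in>{0..N}. L2_signal (d i)) \<longrightarrow>
        (\<exists>e. chain_response K H F G W N d e \<and> L2_l2_norm {1..N} e \<le> c * L2_l2_norm {0..N} d)"
    using assms unfolding L2_l2_string_stable_def by blast
  have "\<exists>e. chain_response K H F G W N d e \<and> (\<forall>k\<in>{1..N}. L2_norm (e k) \<le> c * L2_norm (d i))"
    if i: "i \<in> {0..N}" and d: "L2_signal (d i)" "\<forall>j. j \<noteq> i \<longrightarrow> d j = (\<lambda>t. 0)" for N d i
  proof -
    have "\<forall>j\<in>{0..N}. L2_signal (d j)" using d L2_signal_zero by metis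
    with c obtain e where e: "chain_response K H F G W N d e"
      "L2_l2_norm {1..N} e \<le> c * L2_l2_norm {0..N} d" by blast
    have "(\<Sum>j\<in>{0..N}. LINT t|lborel. (d j t)\<^sup>2) = (\<Sum>j\<in>{0..N}. if j = i then LINT t|lborel. (d i t)\<^sup>2 else 0)"
      using d by (intro sum.cong) auto
    then have "L2_l2_norm {0..N} d = L2_norm (d i)"
      using i by (simp add: L2_l2_norm_def L2_norm_def)
    moreover have "L2_norm (e k) \<le> L2_l2_norm {1..N} e" if "k \<in> {1..N}" for k
      unfolding L2_norm_def L2_l2_norm_def using that
      by (intro real_sqrt_le_mono member_le_sum) auto
    ultimately show ?thesis using e by (metis order_trans)
  qed
  then show ?thesis
    using assms unfolding L2_string_stable_def L2_l2_string_stable_def by blast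
qed

section \<open>Generic gains and the contradictions for (a) and (b)\<close>

lemma finite_real_multiples_eq_1: "finite {c :: real. of_real c * x = (1 :: complex)}"
proof (cases "x = 0")
  case False
  have "{c :: real. of_real c * x = 1} \<subseteq> {Re (1 / x)}"
  proof
    fix c :: real assume "c \<in> {c. of_real c * x = 1}"
    then have "1 / x = of_real c" using False by (simp add: nonzero_divide_eq_eq)
    then show "c \<in> {Re (1 / x)}" by simp
  qed
  then show ?thesis by (rule finite_subset) simp
qed simp

text \<open>Robustness supplies an interval of gains, which no finite set can cover. Any coincidence
  at \<open>s = 0\<close> that occurs for finitely many gains only can thus be avoided.\<close>

lemma robustly_avoiding_gains:
  assumes rob: "robustly P W" and W: "admissible_channel W" and X: "finite X"
  obtains c W' where "c \<notin> X" "P W'" "(W' \<longlongrightarrow> c *\<^sub>R W 0) (at 0)"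
proof -
  obtain \<delta>0 where \<delta>0: "\<delta>0 > 0"
    "\<And>\<delta>. \<bar>\<delta>\<bar> < \<delta>0 \<Longrightarrow> \<exists>W'. P W' \<and> (W' \<longlongrightarrow> (1 + \<delta>) *\<^sub>R W 0) (at 0)"
    by (rule robustly_change_of_gain[OF rob W]) blast
  have "infinite {1<..<1 + \<delta>0}" using \<delta>0(1) by (simp add: infinite_Ioo)
  then have "\<not> {1<..<1 + \<delta>0} \<subseteq> X" using X finite_subset by blast
  then obtain c where "c \<in> {1<..<1 + \<delta>0}" "c \<notin> X" by blast
  then show ?thesis using \<delta>0(2)[of "c - 1"] that by auto
qed

lemma not_L2_l2_string_stable_bounded_gain:
  fixes F :: "complex \<Rightarrow> complex^'n" and H :: "complex \<Rightarrow> complex^'m"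
  assumes comm: "communication_assumption (L2_l2_string_stable K H F G) K H F G W"
    and K0: "\<not> is_pole K 0"
  shows False
proof -
  have K: "transfer_function K" "K 0 \<noteq> 0" and st: "stable_vec H" "stable_vec F" "stable_mat G"
    and W: "admissible_channel W" "robustly (L2_l2_string_stable K H F G) W"
    using comm K0 by (auto simp: communication_assumption_def admissible_controllers_def)
  have K_lim: "(K \<longlongrightarrow> K 0) (at 0)"
    using K K0 by (auto simp: transfer_function_def nicely_meromorphic_on_def)
  define h A where "h = H 0 v* W 0" and "A = G 0 ** W 0"
  \<comment> \<open>The gain \<open>0\<close> is excluded separately, as the finiteness result
    concerns nonzero gains only.\<close>
  have "finite (insert 0 {c. c \<noteq> 0 \<and> (chain_err (K 0) 0 (c *\<^sub>R h) (F 0) (c *\<^sub>R A) \<longlonglongrightarrow> 0)})"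
    using finite_gains_vanishing_errors[OF K(2)] by simp
  from robustly_avoiding_gains[OF W(2,1) this] obtain c W' where
    c: "c \<noteq> 0" "\<not> (chain_err (K 0) 0 (c *\<^sub>R h) (F 0) (c *\<^sub>R A) \<longlonglongrightarrow> 0)"
    and W': "L2_l2_string_stable K H F G W'" "(W' \<longlongrightarrow> c *\<^sub>R W 0) (at 0)"
    by blast
  have "H 0 v* (c *\<^sub>R W 0) = c *\<^sub>R h" "G 0 ** (c *\<^sub>R W 0) = c *\<^sub>R A"
    by (simp_all add: h_def A_def vec_eq_iff vector_matrix_mult_def matrix_matrix_mult_def scaleR_sum_right)
  with L2_l2_string_stable_imp_static_bound[OF W'(1) K_lim K(2) stable_vec_tendsto_0[OF st(1)]
      stable_vec_tendsto_0[OF st(2)] stable_mat_tendsto_0[OF st(3)] W'(2)]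
  obtain C where C: "\<And>N. (\<Sum>i<N. (norm (chain_err (K 0) 0 (c *\<^sub>R h) (F 0) (c *\<^sub>R A) i))\<^sup>2) \<le> C"
    by auto
  then have "summable (\<lambda>i. (norm (chain_err (K 0) 0 (c *\<^sub>R h) (F 0) (c *\<^sub>R A) i))\<^sup>2)"
    by (intro summableI_nonneg_bounded[where x = C]) auto
  then have "(\<lambda>i. (norm (chain_err (K 0) 0 (c *\<^sub>R h) (F 0) (c *\<^sub>R A) i))\<^sup>2) \<longlonglongrightarrow> 0"
    by (rule summable_LIMSEQ_zero)
  from tendsto_real_sqrt[OF this] have "chain_err (K 0) 0 (c *\<^sub>R h) (F 0) (c *\<^sub>R A) \<longlonglongrightarrow> 0"
    by (simp add: tendsto_norm_zero_iff)
  with c show False by blast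
qed

lemma not_L2_string_stable_scalar:
  fixes F :: "complex \<Rightarrow> complex^1" and H :: "complex \<Rightarrow> complex^1"
  assumes comm: "communication_assumption (L2_string_stable K H F G) K H F G W"
  shows False
proof -
  have K: "transfer_function K" "is_pole K 0 \<or> K 0 \<noteq> 0" and st: "stable_vec H" "stable_vec F" "stable_mat G"
    and W: "admissible_channel W" "robustly (L2_string_stable K H F G) W"
    using comm by (auto simp: communication_assumption_def admissible_controllers_def)
  obtain p g g0 where g: "(g \<longlongrightarrow> g0) (at 0)" "g0 \<noteq> 0" "\<forall>\<^sub>F s in at 0. K s = g s / s ^ p"
    by (rule transfer_function_near_0[OF K])
  define a where "a = G 0 $ 1 $ 1 * W 0 $ 1 $ 1"
  define q where "q = H 0 $ 1 * W 0 $ 1 $ 1 * F 0 $ 1"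
  \<comment> \<open>Avoiding the first set keeps \<open>G W\<close> away from \<open>1\<close> at
    \<open>s = 0\<close>, where the small root would lose its leading term; avoiding the second
    keeps the linear coefficient of the quadratic nonzero in the limit.\<close>
  have "finite ({c. of_real c * a = 1} \<union> {c. of_real c * (a - q * (0 ^ p / g0)) = 1})"
    using finite_real_multiples_eq_1 by blast
  from robustly_avoiding_gains[OF W(2,1) this] obtain c W' where
    c: "of_real c * a \<noteq> 1" "of_real c * (a - q * (0 ^ p / g0)) \<noteq> 1"
    and W': "L2_string_stable K H F G W'" "(W' \<longlongrightarrow> c *\<^sub>R W 0) (at 0)"
    by blast
  define A where "A s = G s $ 1 $ 1 * W' s $ 1 $ 1" for s
  define Q where "Q s = H s $ 1 * W' s $ 1 $ 1 * F s $ 1" for s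
  have "(A \<longlongrightarrow> G 0 $ 1 $ 1 * (c *\<^sub>R W 0) $ 1 $ 1) (at 0)"
    unfolding A_def by (intro tendsto_mult tendsto_vec_nth W'(2) stable_mat_tendsto_0[OF st(3)])
  then have A: "(A \<longlongrightarrow> of_real c * a) (at 0)"
    by (simp add: a_def scaleR_conv_of_real[where 'a = complex] mult_ac)
  have "(Q \<longlongrightarrow> H 0 $ 1 * (c *\<^sub>R W 0) $ 1 $ 1 * F 0 $ 1) (at 0)"
    unfolding Q_def by (intro tendsto_mult tendsto_vec_nth W'(2) stable_vec_tendsto_0 st)
  then have Q: "(Q \<longlongrightarrow> of_real c * q) (at 0)"
    by (simp add: q_def scaleR_conv_of_real[where 'a = complex] mult_ac)
  have b0: "1 - of_real c * a + of_real c * q * (0 ^ p / g0) \<noteq> 0"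
    using c(2) by (simp add: algebra_simps)
  obtain w where w: "Re w > 0" and ev: "\<forall>\<^sub>F t in at_right (0 :: real). \<forall>s. s = of_real t * w \<longrightarrow> K s + s\<^sup>2 \<noteq> 0 \<and>
      (\<exists>l1 l2. l1 + l2 = A s + (K s - Q s) / (K s + s\<^sup>2) \<and>
        l1 * l2 = (A s * K s - Q s) / (K s + s\<^sup>2) \<and> norm l1 > 1 \<and> l1 \<noteq> A s)"
    by (rule unstable_characteristic_root[OF g A c(1) Q b0])
  obtain t0 where t0: "t0 > 0" and root: "\<And>t s. 0 < t \<Longrightarrow> t < t0 \<Longrightarrow> s = of_real t * w \<Longrightarrow> K s + s\<^sup>2 \<noteq> 0 \<and>
      (\<exists>l1 l2. l1 + l2 = A s + (K s - Q s) / (K s + s\<^sup>2) \<and>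
        l1 * l2 = (A s * K s - Q s) / (K s + s\<^sup>2) \<and> norm l1 > 1 \<and> l1 \<noteq> A s)"
    using ev by (auto simp: eventually_at_right_field)
  obtain t B where t: "0 < t" "t < t0" and bound: "\<And>s i. s = of_real t * w \<Longrightarrow> K s + s\<^sup>2 \<noteq> 0 \<Longrightarrow>
      norm (chain_err (K s) (s\<^sup>2) (H s v* W' s) (F s) (G s ** W' s) i) \<le> B"
    using L2_string_stable_imp_bounded_errors[OF W'(1) w order_refl t0] by blast
  define s where "s = of_real t * w"
  obtain l1 l2 where nz: "K s + s\<^sup>2 \<noteq> 0"
    and l: "l1 + l2 = A s + (K s - Q s) / (K s + s\<^sup>2)" "l1 * l2 = (A s * K s - Q s) / (K s + s\<^sup>2)"
      "norm l1 > 1" "l1 \<noteq> A s"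
    using root[OF t s_def] by blast
  define T where "T = chain_err (K s) (s\<^sup>2) (H s v* W' s) (F s) (G s ** W' s)"
  have A1: "(G s ** W' s) $ 1 $ 1 = A s" by (simp add: A_def matrix_matrix_mult_def sum_1)
  have Q1: "(H s v* W' s) $ 1 * F s $ 1 = Q s" by (simp add: Q_def vector_matrix_mult_def sum_1)
  have T: "T (Suc i) - l2 * T i = (l1 - A s) * l1 ^ i / (K s + s\<^sup>2)" for i
    unfolding T_def using chain_err_scalar[OF nz, of l1 l2 "G s ** W' s" "H s v* W' s" "F s" i] l(1,2)
    by (simp add: A1 Q1)
  \<comment> \<open>Bounded errors would bound the geometric sequence \<open>l1 ^ i\<close>, whose
    factor is nonzero because \<open>l1 \<noteq> A s\<close>.\<close>
  define M where "M = (B + norm l2 * B) / norm ((l1 - A s) / (K s + s\<^sup>2))"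
  have "norm l1 ^ i \<le> M" for i
  proof -
    have "norm (T (Suc i) - l2 * T i) \<le> norm (T (Suc i)) + norm l2 * norm (T i)"
      by (metis norm_mult norm_triangle_ineq4)
    also have "\<dots> \<le> B + norm l2 * B"
      using bound[OF s_def nz] by (intro add_mono mult_left_mono) (auto simp: T_def)
    finally have "norm ((l1 - A s) / (K s + s\<^sup>2)) * norm l1 ^ i \<le> B + norm l2 * B"
      unfolding T by (simp add: norm_mult norm_divide norm_power)
    moreover have "norm ((l1 - A s) / (K s + s\<^sup>2)) > 0" using l(4) nz by simp
    ultimately show ?thesis unfolding M_def by (simp only: pos_le_divide_eq mult.commute)
  qed
  moreover obtain i where "M < norm l1 ^ i" using real_arch_pow[OF l(3)] by blast
  ultimately show False by (meson not_le)
qed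

theorem theorem4:
  shows "(\<not> (\<exists>(K :: complex \<Rightarrow> complex) (H :: complex \<Rightarrow> complex^'m) (F :: complex \<Rightarrow> complex^'n)
              (G :: complex \<Rightarrow> complex^'m^'n) (W :: complex \<Rightarrow> complex^'n^'m).
            communication_assumption (L2_l2_string_stable K H F G) K H F G W \<and>
            \<not> is_pole K 0 \<and>
            L2_l2_string_stable K H F G W)) \<and>
         (\<not> (\<exists>(K :: complex \<Rightarrow> complex) (H :: complex \<Rightarrow> complex^1) (F :: complex \<Rightarrow> complex^1)
              (G :: complex \<Rightarrow> complex^1^1) (W :: complex \<Rightarrow> complex^1^1).
            communication_assumption (L2_string_stable K H F G) K H F G W \<and>
            L2_string_stable K H F G W)) \<and>
         (\<not> (\<exists>(K :: complex \<Rightarrow> complex) (H :: complex \<Rightarrow> complex^1) (F :: complex \<Rightarrow> complex^1)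
              (G :: complex \<Rightarrow> complex^1^1) (W :: complex \<Rightarrow> complex^1^1).
            communication_assumption (L2_l2_string_stable K H F G) K H F G W \<and>
            L2_l2_string_stable K H F G W))"
proof -
  \<comment> \<open>Robustness of the stronger notion implies robustness of the weaker one, so the
    third claim reduces to the second.\<close>
  have "communication_assumption (L2_string_stable K H F G) K H F G W"
    if "communication_assumption (L2_l2_string_stable K H F G) K H F G W"
    for K and H F :: "complex \<Rightarrow> complex^1" and G W
    using that L2_l2_string_stable_imp_L2_string_stable
    unfolding communication_assumption_def robustly_def by blast
  then show ?thesis
    using not_L2_l2_string_stable_bounded_gain not_L2_string_stable_scalar by blast
qed

end
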